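(* Let $f:\mathbb{N}\to\mathbb{R}$ be bounded and let $T>0$. Then $$\log\left(\int_{\mathbb{N}}e^f\,d\pi_T\right)=\sup_\lambda\left\{\mathbb{E}\left[f(X^\lambda_T)-\int_0^T\left(\lambda_t\log\lambda_t-\lambda_t+1\right)dt\right]\right\},$$ where the supremum is taken over all bounded, non-negative, predictable processes $(\lambda_t)_{0\le t\le T}$, and $(X^\lambda_t)_{0\le t\le T}$ is the counting process associated with $\lambda$. Moreover, the supremum is actually a maximum.
   Context: $\mathbb{N}=\{0,1,2,\dots\}$, $\mathbb{R}_+=[0,\infty)$, and $\pi_T$ is the Poisson measure with parameter $T$: $\pi_T(\{n\})=\frac{T^n}{n!}e^{-T}$ for $n\in\mathbb{N}$. The convention $0\log 0=0$ is used. Let $(\Omega,\mathcal{F},\mathbb{P})$ be a probability space carrying a Poisson point process $N$ on $[0,T]\times\mathbb{R}_+\subseteq\mathbb{R}^2$ with intensity measure equal to the Lebesgue measure. For a Borel set $E\subseteq[0,T]\times\mathbb{R}_+$ let $\mathcal{F}_E$ be the $\sigma$-field generated by the random variables $N(F)$, $F\subseteq E$ Borel, and for $t\in[0,T]$ let $\mathcal{F}_t=\mathcal{F}_{[0,t]\times\mathbb{R}_+}$. A stochastic process $(\lambda_t)_{0\le t\le T}$ is predictable if, as a function of $(t,\omega)\in[0,T]\times\Omega$, it is measurable with respect to the $\sigma$-field $\mathcal{P}$ generated by the sets $(s,t]\times A$ with $s\le t\le T$ and $A\in\mathcal{F}_s$. For a predictable, bounded, non-negative process $\lambda$, the associated counting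 process is $$X^\lambda_t=N\left(\{(s,u)\in[0,T]\times\mathbb{R}_+ : s<t,\ u\le\lambda_s\}\right),\qquad 0\le t\le T.$$ *)

theory Defs
  imports "HOL-Probability.Probability"
begin

text \<open>
  A point process is a random measure with values in the locally finite,
  integer-valued measures. The intensity \<open>\<nu>\<close> fixes the state space and its
  \<open>\<sigma>\<close>-algebra. Independence along disjoint sequences includes
  independence along finite disjoint families (pad with empty sets). The law of the
  number of points is prescribed only for sets of finite intensity; infinite intensity
  then forces infinitely many points almost surely for \<open>\<sigma>\<close>-finite \<open>\<nu>\<close>.
\<close>

locale poisson_point_process = prob_space M
  for M :: "'a measure" and \<nu> :: "'b::metric_space measure" and N :: "'a \<Rightarrow> 'b measure" +
  assumes sets_config: "\<omega> \<in> space M \<Longrightarrow> sets (N \<omega>) = sets \<nu>"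
    and integer_valued: "\<omega> \<in> space M \<Longrightarrow> F \<in> sets \<nu> \<Longrightarrow>
      emeasure (N \<omega>) F = \<infinity> \<or> (\<exists>n::nat. emeasure (N \<omega>) F = of_nat n)"
    and locally_finite: "\<omega> \<in> space M \<Longrightarrow> F \<in> sets \<nu> \<Longrightarrow> bounded F \<Longrightarrow> emeasure (N \<omega>) F < \<infinity>"
    and measurable_count: "F \<in> sets \<nu> \<Longrightarrow> (\<lambda>\<omega>. emeasure (N \<omega>) F) \<in> borel_measurable M"
    and poisson_count: "F \<in> sets \<nu> \<Longrightarrow> emeasure \<nu> F < \<infinity> \<Longrightarrow>
      prob {\<omega> \<in> space M. emeasure (N \<omega>) F = of_nat n}
        = measure \<nu> F ^ n / fact n * exp (- measure \<nu> F)"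
    and indep_counts: "range G \<subseteq> sets \<nu> \<Longrightarrow> disjoint_family G \<Longrightarrow>
      indep_vars (\<lambda>_. borel) (\<lambda>i \<omega>. emeasure (N \<omega>) (G i)) (UNIV :: nat set)"

definition strip :: "real \<Rightarrow> (real \<times> real) set" where
  "strip T = {0..T} \<times> {0..}"

definition strip_lebesgue :: "real \<Rightarrow> (real \<times> real) measure" where
  "strip_lebesgue T = restrict_space lborel (strip T)"

definition sigma_field_of :: "'a measure \<Rightarrow> ('a \<Rightarrow> (real \<times> real) measure) \<Rightarrow> (real \<times> real) set \<Rightarrow> 'a measure"
  where "sigma_field_of M N E =
    sigma (space M)
      {(\<lambda>\<omega>. emeasure (N \<omega>) F) -` B \<inter> space M | F B. F \<in> sets borel \<and> F \<subseteq> E \<and> B \<in> sets borel}"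

definition history :: "'a measure \<Rightarrow> ('a \<Rightarrow> (real \<times> real) measure) \<Rightarrow> real \<Rightarrow> 'a measure" where
  "history M N t = sigma_field_of M N (strip t)"

definition predictable_sigma :: "real \<Rightarrow> 'a measure \<Rightarrow> ('a \<Rightarrow> (real \<times> real) measure) \<Rightarrow> (real \<times> 'a) measure"
  where "predictable_sigma T M N =
    sigma ({0..T} \<times> space M)
      {{s<..t} \<times> A | s t A. 0 \<le> s \<and> s \<le> t \<and> t \<le> T \<and> A \<in> sets (history M N s)}"

text \<open>
  Processes are total functions of type \<open>real \<Rightarrow> 'a \<Rightarrow> real\<close>; only their values on
  \<open>[0,T] \<times> \<Omega>\<close> are constrained or used.
\<close>

definition admissible :: "real \<Rightarrow> 'a measure \<Rightarrow> ('a \<Rightarrow> (real \<times> real) measure) \<Rightarrow> (real \<Rightarrow> 'a \<Rightarrow> real) set"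
  where "admissible T M N = {\<Lambda>.
    (\<lambda>(t, \<omega>). \<Lambda> t \<omega>) \<in> borel_measurable (predictable_sigma T M N) \<and>
    (\<forall>t\<in>{0..T}. \<forall>\<omega>\<in>space M. 0 \<le> \<Lambda> t \<omega>) \<and>
    (\<exists>C. \<forall>t\<in>{0..T}. \<forall>\<omega>\<in>space M. \<Lambda> t \<omega> \<le> C)}"

text \<open>
  For bounded \<open>\<Lambda>\<close> the region below has finitely many points, so its measure is
  already a natural number and the rounding merely changes the type.
\<close>

definition counting_process ::
    "real \<Rightarrow> ('a \<Rightarrow> (real \<times> real) measure) \<Rightarrow> (real \<Rightarrow> 'a \<Rightarrow> real) \<Rightarrow> real \<Rightarrow> 'a \<Rightarrow> nat"
  where "counting_process T N \<Lambda> t \<omega> =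
    nat \<lfloor>measure (N \<omega>) {(s, u) \<in> strip T. s < t \<and> u \<le> \<Lambda> s \<omega>}\<rfloor>"

text \<open>Since \<open>ln 0 = 0\<close>, the convention \<open>0 log 0 = 0\<close> holds automatically.\<close>

definition objective ::
    "real \<Rightarrow> 'a measure \<Rightarrow> ('a \<Rightarrow> (real \<times> real) measure) \<Rightarrow> (nat \<Rightarrow> real) \<Rightarrow> (real \<Rightarrow> 'a \<Rightarrow> real) \<Rightarrow> real"
  where "objective T M N f \<Lambda> =
    (\<integral>\<omega>. (f (counting_process T N \<Lambda> T \<omega>)
        - (LINT t:{0..T}|lborel. (\<Lambda> t \<omega> * ln (\<Lambda> t \<omega>) - \<Lambda> t \<omega> + 1))) \<partial>M)"

end

theory Submission
  imports Defs
begin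

text \<open>
  Let \<open>\<phi>(t, n)\<close> be the logarithm of the mean of \<open>exp (f (n + P))\<close>, where \<open>P\<close> is Poisson with
  parameter \<open>T - t\<close>, and let \<open>D\<phi>(t, n) = \<phi>(t, n + 1) - \<phi>(t, n)\<close>. Then \<open>\<phi>(T, n) = f n\<close>,
  \<open>\<phi>(0, 0)\<close> is the left-hand side of the formula, and differentiating the Poisson weights gives
  the backward equation \<open>\<partial>\<phi>/\<partial>t = 1 - exp (D\<phi>)\<close> (lemma \<open>log_value_deriv\<close>).

  For a control \<open>\<Lambda>\<close> with counting process \<open>X\<close>, the Dynkin formula (lemma \<open>dynkin_formula\<close>) says that
  the expectation of \<open>f (X T)\<close> exceeds \<open>\<phi>(0, 0)\<close> by the expected time integral of
  \<open>\<Lambda> D\<phi> - exp (D\<phi>) + 1\<close> along the path. Subtracting the cost, the objective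
  equals \<open>\<phi>(0, 0)\<close> minus the expected time integral of
  \<open>(\<Lambda> ln \<Lambda> - \<Lambda> + 1) - (\<Lambda> D\<phi> - exp (D\<phi>) + 1)\<close> (lemma \<open>objective_eq\<close>). This gap is
  nonnegative by the Legendre duality between \<open>x ln x - x + 1\<close> and \<open>exp y - 1\<close>, and it vanishes
  exactly when \<open>\<Lambda> = exp (D\<phi>)\<close>. So every objective is at most \<open>\<phi>(0, 0)\<close>, and equality is attained
  by a control that solves the feedback equation \<open>\<Lambda> t = exp (D\<phi>(t, X t))\<close>.

  Three facts carry the proof. First, the number of points under a predictable graph is compensated
  by the area under it, conditionally on the past (lemmas \<open>campbell_predictable\<close> and
  \<open>compensated_jumps_orthogonal\<close>). It is a Dynkin class argument that starts from the
  independence of the past and the points to come. Second, the Dynkin formula is obtained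
  without following the individual jumps: on \<open>[a, b]\<close> the two sides differ by \<open>O((b - a)\<^sup>2)\<close>,
  because two or more points in a slab of width \<open>b - a\<close> have probability of that order, and a function whose
  increments are quadratically small is constant. Third, the feedback equation is
  solved path by path by Picard iteration (lemma \<open>feedback_control_exists\<close>). Only finitely many points lie
  below the bound of the feedback, and each iteration makes the solution correct up to one further jump time,
  so the iteration becomes stationary on every path; each iterate is predictable, and so is the limit.
\<close>

section \<open>Poisson sums and other preliminaries\<close>

text \<open>
  The first two factorial moments of the Poisson distribution, written as sums. The
  second one controls the event that a thin slab contains at least two points.
\<close>
lemma poisson_mean: "(\<lambda>n. real n * (x ^ n / fact n * exp (- x))) sums (x::real)"
proof -
  have "(\<lambda>n. x ^ n / fact n) sums exp x"
    using exp_converges[of x] by (simp add: field_simps)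
  then have "(\<lambda>n. (x ^ n / fact n) * (x * exp (-x))) sums (exp x * (x * exp (-x)))"
    by (rule sums_mult2)
  then have *: "(\<lambda>n. (x ^ n / fact n) * (x * exp (-x))) sums x"
    by (simp add: exp_minus field_simps)
  moreover have "(\<lambda>n. (x ^ n / fact n) * (x * exp (-x))) =
     (\<lambda>n. real (Suc n) * (x ^ Suc n / fact (Suc n) * exp (- x)))"
    by (intro ext) (simp add: divide_simps del: of_nat_Suc)
  ultimately have "(\<lambda>n. real (Suc n) * (x ^ Suc n / fact (Suc n) * exp (- x))) sums x"
    by simp
  then show ?thesis
    by (subst (asm) sums_Suc_iff) simp
qed

lemma poisson_second_factorial_moment:
  "(\<lambda>n. real (n * (n - 1)) * (x ^ n / fact n * exp (- x))) sums (x\<^sup>2::real)"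
proof -
  have *: "(\<lambda>n. x * (real n * (x ^ n / fact n * exp (- x)))) sums (x * x)"
    using poisson_mean by (rule sums_mult)
  have "(\<lambda>n. x * (real n * (x ^ n / fact n * exp (- x)))) =
     (\<lambda>n. real (Suc n * (Suc n - 1)) * (x ^ Suc n / fact (Suc n) * exp (- x)))"
    by (intro ext) (simp add: divide_simps del: of_nat_Suc, simp add: algebra_simps)
  with * have "(\<lambda>n. real (Suc n * (Suc n - 1)) * (x ^ Suc n / fact (Suc n) * exp (- x))) sums (x\<^sup>2)"
    by (simp add: power2_eq_square)
  then show ?thesis
    by (subst (asm) sums_Suc_iff) simp
qed

lemma suminf_of_nat_ennreal:
  assumes "(\<lambda>n. real (h n) * p n) sums (s::real)" "\<And>n. p n \<ge> 0"
  shows "(\<Sum>n. of_nat (h n) * ennreal (p n)) = ennreal s"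
proof -
  have "(\<Sum>n. of_nat (h n) * ennreal (p n)) = (\<Sum>n. ennreal (real (h n) * p n))"
    by (simp add: ennreal_mult' ennreal_of_nat_eq_real_of_nat)
  also have "\<dots> = ennreal (\<Sum>n. real (h n) * p n)"
    using assms by (intro suminf_ennreal2) (auto simp: sums_iff)
  finally show ?thesis using assms by (simp add: sums_iff)
qed

lemma nn_integral_nat_valued:
  fixes M :: "'a measure" and X :: "'a \<Rightarrow> nat" and h :: "nat \<Rightarrow> ennreal"
  assumes [measurable]: "X \<in> M \<rightarrow>\<^sub>M count_space UNIV" "A \<in> sets M"
  shows "(\<integral>\<^sup>+\<omega>. h (X \<omega>) * indicator A \<omega> \<partial>M)
    = (\<Sum>n. h n * emeasure M (A \<inter> {\<omega>\<in>space M. X \<omega> = n}))"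
proof -
  have "(\<integral>\<^sup>+\<omega>. h (X \<omega>) * indicator A \<omega> \<partial>M)
      = (\<integral>\<^sup>+\<omega>. (\<Sum>n. h n * indicator (A \<inter> {\<omega>\<in>space M. X \<omega> = n}) \<omega>) \<partial>M)"
  proof (rule nn_integral_cong)
    fix \<omega> assume "\<omega> \<in> space M"
    have "(\<Sum>n. h n * indicator (A \<inter> {\<omega>\<in>space M. X \<omega> = n}) \<omega>)
       = (\<Sum>n\<in>{X \<omega>}. h n * indicator (A \<inter> {\<omega>\<in>space M. X \<omega> = n}) \<omega>)"
      by (rule suminf_finite) (auto simp: indicator_def)
    then show "h (X \<omega>) * indicator A \<omega> = (\<Sum>n. h n * indicator (A \<inter> {\<omega>\<in>space M. X \<omega> = n}) \<omega>)"
      using \<open>\<omega> \<in> space M\<close> by (simp add: indicator_def)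
  qed
  also have "\<dots> = (\<Sum>n. h n * emeasure M (A \<inter> {\<omega>\<in>space M. X \<omega> = n}))"
    by (subst nn_integral_suminf) (auto simp: nn_integral_cmult_indicator)
  finally show ?thesis .
qed

lemma emeasure_vertical_line: "emeasure lborel (F \<inter> {a} \<times> UNIV :: (real \<times> real) set) = 0"
proof -
  have "emeasure (lborel \<Otimes>\<^sub>M lborel) ({a} \<times> (UNIV :: real set)) = 0"
    by (subst lborel.emeasure_pair_measure_Times) auto
  then have "emeasure lborel ({a} \<times> (UNIV :: real set)) = 0"
    by (simp add: lborel_prod)
  then show ?thesis
    using emeasure_mono[of "F \<inter> {a} \<times> UNIV" "{a} \<times> UNIV" lborel]
    by (auto simp: closed_Times)
qed

text \<open>
  Cutting \<open>[0, T]\<close> into \<open>m\<close> pieces bounds the total increment by \<open>m L (T / m)\<^sup>2\<close>, which tends to 0.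
  With this lemma a pathwise change of variables formula can be replaced by a local estimate in expectation.
\<close>
lemma constant_if_quadratic_increments:
  fixes h :: "real \<Rightarrow> real"
  assumes "0 \<le> T" and h: "\<And>a b. 0 \<le> a \<Longrightarrow> a \<le> b \<Longrightarrow> b \<le> T \<Longrightarrow> \<bar>h b - h a\<bar> \<le> L * (b - a)\<^sup>2"
  shows "h T = h 0"
proof -
  have bound: "\<bar>h T - h 0\<bar> \<le> L * T\<^sup>2 * inverse (real (Suc n))" for n
  proof -
    define x where "x k = T * (real k / real (Suc n))" for k
    have "\<bar>h T - h 0\<bar> = \<bar>\<Sum>k<Suc n. h (x (Suc k)) - h (x k)\<bar>"
    proof -
      have "x (Suc n) = T" "x 0 = 0" by (simp_all add: x_def del: of_nat_Suc)
      then show ?thesis using sum_lessThan_telescope[of "\<lambda>k. h (x k)" "Suc n"] by simp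
    qed
    also have "\<dots> \<le> (\<Sum>k<Suc n. L * (T / real (Suc n))\<^sup>2)"
    proof (intro order_trans[OF sum_abs] sum_mono)
      fix k assume k: "k \<in> {..<Suc n}"
      have "0 \<le> x k" "x k \<le> x (Suc k)"
        unfolding x_def using assms(1) by (auto intro!: mult_left_mono divide_right_mono)
      moreover have "x (Suc k) \<le> T"
        unfolding x_def using assms(1) k by (intro mult_left_le) auto
      moreover have "x (Suc k) - x k = T / real (Suc n)"
        unfolding x_def right_diff_distrib[symmetric] diff_divide_distrib[symmetric] by simp
      ultimately show "\<bar>h (x (Suc k)) - h (x k)\<bar> \<le> L * (T / real (Suc n))\<^sup>2"
        using h[of "x k" "x (Suc k)"] by simp
    qed
    also have "\<dots> = L * T\<^sup>2 * inverse (real (Suc n))"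
      by (simp add: power2_eq_square divide_simps del: of_nat_Suc)
    finally show ?thesis .
  qed
  have "(\<lambda>n. L * T\<^sup>2 * inverse (real (Suc n))) \<longlonglongrightarrow> L * T\<^sup>2 * 0"
    by (intro tendsto_intros LIMSEQ_inverse_real_of_nat)
  then have "\<bar>h T - h 0\<bar> \<le> L * T\<^sup>2 * 0"
    using bound by (intro tendsto_lowerbound[where F=sequentially]) auto
  then show ?thesis by simp
qed

section \<open>Counts of a Poisson process on the strip\<close>

locale strip_poisson = poisson_point_process M "strip_lebesgue T" N
  for M :: "'a measure" and T :: real and N :: "'a \<Rightarrow> (real \<times> real) measure" +
  assumes T_pos: "T > 0"
begin

lemma strip_borel [measurable]: "strip t \<in> sets borel"
  unfolding strip_def by (intro borel_closed closed_Times) auto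

lemma sets_strip_lebesgue: "F \<in> sets (strip_lebesgue T) \<longleftrightarrow> F \<in> sets borel \<and> F \<subseteq> strip T"
  unfolding strip_lebesgue_def by (subst sets_restrict_space_iff) auto

lemma emeasure_strip_lebesgue:
  "F \<subseteq> strip T \<Longrightarrow> emeasure (strip_lebesgue T) F = emeasure lborel F"
  unfolding strip_lebesgue_def by (subst emeasure_restrict_space) auto

lemma sets_N: "\<omega> \<in> space M \<Longrightarrow> F \<in> sets (N \<omega>) \<longleftrightarrow> F \<in> sets borel \<and> F \<subseteq> strip T"
  using sets_config sets_strip_lebesgue by blast

text \<open>
  The rounding changes nothing on bounded sets, where the point configuration has a finite integer mass;
  it only provides the type of natural numbers.
\<close>
definition count :: "(real \<times> real) set \<Rightarrow> 'a \<Rightarrow> nat" where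
  "count F \<omega> = nat \<lfloor>measure (N \<omega>) F\<rfloor>"

text \<open>
  Bounded Borel subsets of the strip: the sets whose number of points is finite for every
  outcome, so that no exceptional null set appears in what follows.
\<close>
definition boxed :: "(real \<times> real) set \<Rightarrow> bool" where
  "boxed F \<longleftrightarrow> F \<in> sets borel \<and> F \<subseteq> strip T \<and> bounded F"

lemma boxedD: "boxed F \<Longrightarrow> F \<in> sets (strip_lebesgue T)"
  by (simp add: boxed_def sets_strip_lebesgue)

lemma boxed_subset: "boxed F \<Longrightarrow> G \<subseteq> F \<Longrightarrow> G \<in> sets borel \<Longrightarrow> boxed G"
  unfolding boxed_def by (auto intro: bounded_subset)

lemma emeasure_N:
  assumes "\<omega> \<in> space M" "boxed F"
  shows "emeasure (N \<omega>) F = of_nat (count F \<omega>)"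
proof -
  have "emeasure (N \<omega>) F < \<infinity>" "emeasure (N \<omega>) F = \<infinity> \<or> (\<exists>n::nat. emeasure (N \<omega>) F = of_nat n)"
    using assms locally_finite integer_valued by (auto simp: boxedD boxed_def)
  then obtain n where "emeasure (N \<omega>) F = of_nat n"
    by auto
  then show ?thesis
    by (simp add: count_def measure_def)
qed

lemma count_measurable [measurable]:
  assumes "boxed F" shows "count F \<in> M \<rightarrow>\<^sub>M count_space UNIV"
proof -
  have "(\<lambda>\<omega>. emeasure (N \<omega>) F) \<in> borel_measurable M"
    by (rule measurable_count[OF boxedD[OF assms]])
  then show ?thesis
    unfolding count_def measure_def by measurable
qed

lemma count_Un:
  assumes "\<omega> \<in> space M" "boxed F" "boxed G" "F \<inter> G = {}"
  shows "count (F \<union> G) \<omega> = count F \<omega> + count G \<omega>"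
proof -
  have "boxed (F \<union> G)" using assms by (auto simp: boxed_def)
  moreover have "emeasure (N \<omega>) (F \<union> G) = emeasure (N \<omega>) F + emeasure (N \<omega>) G"
    using assms by (intro plus_emeasure[symmetric]) (auto simp: sets_N boxed_def)
  ultimately have "of_nat (count (F \<union> G) \<omega>) = (of_nat (count F \<omega> + count G \<omega>) :: ennreal)"
    using assms by (simp add: emeasure_N)
  then show ?thesis by (simp only: of_nat_eq_iff)
qed

lemma count_mono:
  assumes "\<omega> \<in> space M" "boxed G" "F \<subseteq> G" "F \<in> sets borel"
  shows "count F \<omega> \<le> count G \<omega>"
proof -
  have "boxed F" "boxed (G - F)" "F \<union> (G - F) = G" "F \<inter> (G - F) = {}"
    using assms by (auto simp: boxed_def intro: bounded_subset)
  then show ?thesis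
    using count_Un[OF assms(1), of F "G - F"] by simp
qed

lemma count_empty [simp]: "count {} \<omega> = 0"
  by (simp add: count_def)

lemma emeasure_boxed:
  assumes "boxed F"
  shows "emeasure lborel F = ennreal (measure lborel F)"
  using assms emeasure_bounded_finite[of F]
  by (intro emeasure_eq_ennreal_measure) (auto simp: boxed_def less_top)

lemma prob_count:
  assumes "boxed F"
  shows "prob {\<omega> \<in> space M. count F \<omega> = n}
    = measure lborel F ^ n / fact n * exp (- measure lborel F)"
proof -
  have sub: "F \<subseteq> strip T" using assms by (simp add: boxed_def)
  have "{\<omega> \<in> space M. count F \<omega> = n} = {\<omega> \<in> space M. emeasure (N \<omega>) F = of_nat n}"
    using emeasure_N[OF _ assms] by auto
  moreover have "measure (strip_lebesgue T) F = measure lborel F"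
    by (simp add: measure_def emeasure_strip_lebesgue[OF sub])
  ultimately show ?thesis
    using poisson_count[OF boxedD[OF assms], of n] sub emeasure_boxed[OF assms]
    by (simp add: emeasure_strip_lebesgue)
qed

text \<open>
  A count is Poisson distributed with the Lebesgue measure of the set as its parameter, so its moments are those of the
  Poisson distribution.
\<close>
lemma nn_integral_of_count:
  assumes "boxed F"
  shows "(\<integral>\<^sup>+\<omega>. of_nat (h (count F \<omega>)) \<partial>M)
    = (\<Sum>n. of_nat (h n) * ennreal (measure lborel F ^ n / fact n * exp (- measure lborel F)))"
proof -
  note [measurable] = count_measurable[OF assms]
  have "(\<integral>\<^sup>+\<omega>. of_nat (h (count F \<omega>)) \<partial>M)
    = (\<integral>\<^sup>+\<omega>. of_nat (h (count F \<omega>)) * indicator (space M) \<omega> \<partial>M)"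
    by (intro nn_integral_cong) simp
  also have "\<dots> = (\<Sum>n. of_nat (h n) * emeasure M (space M \<inter> {\<omega>\<in>space M. count F \<omega> = n}))"
    by (rule nn_integral_nat_valued) auto
  also have "\<dots> = (\<Sum>n. of_nat (h n) * ennreal (measure lborel F ^ n / fact n * exp (- measure lborel F)))"
    by (simp add: Int_absorb1 Collect_restrict emeasure_eq_measure prob_count[OF assms])
  finally show ?thesis .
qed

lemma nn_integral_count:
  assumes "boxed F"
  shows "(\<integral>\<^sup>+\<omega>. of_nat (count F \<omega>) \<partial>M) = emeasure lborel F"
  unfolding nn_integral_of_count[OF assms, of "\<lambda>n. n"] emeasure_boxed[OF assms]
  by (intro suminf_of_nat_ennreal poisson_mean) simp

lemma nn_integral_count_pair:
  assumes "boxed F"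
  shows "(\<integral>\<^sup>+\<omega>. of_nat (count F \<omega> * (count F \<omega> - 1)) \<partial>M) = ennreal ((measure lborel F)\<^sup>2)"
  unfolding nn_integral_of_count[OF assms, of "\<lambda>n. n * (n - 1)"]
  by (intro suminf_of_nat_ennreal poisson_second_factorial_moment) simp

section \<open>Independence of the past and the points to come\<close>

lemma sets_history: "sets (history M N a) = sigma_sets (space M)
   {(\<lambda>\<omega>. emeasure (N \<omega>) F) -` B \<inter> space M | F B. F \<in> sets borel \<and> F \<subseteq> strip a \<and> B \<in> sets borel}"
  unfolding history_def sigma_field_of_def by (rule sets_measure_of) auto

lemma space_history [simp]: "space (history M N a) = space M"
  unfolding history_def sigma_field_of_def by (rule space_measure_of) auto

lemma history_mono: "a \<le> b \<Longrightarrow> sets (history M N a) \<subseteq> sets (history M N b)"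
  unfolding sets_history by (intro sigma_sets_mono') (fastforce simp: strip_def)

lemma history_subset:
  assumes "a \<le> T" shows "sets (history M N a) \<subseteq> sets M"
  unfolding sets_history
proof (intro sets.sigma_sets_subset subsetI, clarify)
  fix F and B :: "ennreal set"
  assume *: "F \<in> sets borel" "F \<subseteq> strip a" "B \<in> sets borel"
  have "F \<in> sets (strip_lebesgue T)"
    using * assms by (auto simp: sets_strip_lebesgue strip_def)
  from measurable_sets[OF measurable_count[OF this] *(3)]
  show "(\<lambda>\<omega>. emeasure (N \<omega>) F) -` B \<inter> space M \<in> sets M" .
qed

text \<open>
  Events that depend on the counts of finitely many, possibly overlapping, sets: an
  intersection-stable generator of the history at time \<open>a\<close>.
\<close>
definition cylinders :: "real \<Rightarrow> 'a set set" where
  "cylinders a = {{\<omega>\<in>space M. \<forall>i<n. emeasure (N \<omega>) (F i) \<in> B i} | n F B.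
     \<forall>i::nat. F i \<in> sets borel \<and> F i \<subseteq> strip a \<and> B i \<in> sets borel}"

lemma cylinders_Int_stable: "Int_stable (cylinders a)"
proof (rule Int_stableI)
  fix A A' assume "A \<in> cylinders a" "A' \<in> cylinders a"
  then obtain n F B n' F' B' where
    A: "A = {\<omega>\<in>space M. \<forall>i<n. emeasure (N \<omega>) (F i) \<in> B i}"
       "\<forall>i::nat. F i \<in> sets borel \<and> F i \<subseteq> strip a \<and> B i \<in> sets borel" and
    A': "A' = {\<omega>\<in>space M. \<forall>i<n'. emeasure (N \<omega>) (F' i) \<in> B' i}"
       "\<forall>i::nat. F' i \<in> sets borel \<and> F' i \<subseteq> strip a \<and> B' i \<in> sets borel"
    unfolding cylinders_def by blast
  define F2 where "F2 = (\<lambda>i. if i < n then F i else F' (i - n))"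
  define B2 where "B2 = (\<lambda>i. if i < n then B i else B' (i - n))"
  have "(\<forall>i<n + n'. emeasure (N \<omega>) (F2 i) \<in> B2 i) \<longleftrightarrow>
    (\<forall>i<n. emeasure (N \<omega>) (F i) \<in> B i) \<and> (\<forall>i<n'. emeasure (N \<omega>) (F' i) \<in> B' i)" (is "?L \<longleftrightarrow> ?R") for \<omega>
  proof
    assume L: ?L
    show ?R
    proof (intro conjI allI impI)
      fix i assume "i < n" then show "emeasure (N \<omega>) (F i) \<in> B i"
        using L[rule_format, of i] by (simp add: F2_def B2_def)
    next
      fix i assume "i < n'" then show "emeasure (N \<omega>) (F' i) \<in> B' i"
        using L[rule_format, of "n + i"] by (simp add: F2_def B2_def)
    qed
  qed (auto simp: F2_def B2_def)
  then have "A \<inter> A' = {\<omega>\<in>space M. \<forall>i<n + n'. emeasure (N \<omega>) (F2 i) \<in> B2 i}"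
    unfolding A A' by auto
  moreover have "\<forall>i::nat. F2 i \<in> sets borel \<and> F2 i \<subseteq> strip a \<and> B2 i \<in> sets borel"
    using A(2) A'(2) by (auto simp: F2_def B2_def)
  ultimately show "A \<inter> A' \<in> cylinders a" unfolding cylinders_def by blast
qed

text \<open>
  Independence is given for disjoint sets only, while a cylinder may involve overlapping sets
  \<open>E 0, \<dots>, E (n - 1)\<close>. The strip is therefore split into the atoms of the finite Boolean algebra
  that they generate. Indexing the atom of a point \<open>x\<close> by the binary encoding of the set of all \<open>i < n\<close> with
  \<open>x \<in> E i\<close> makes the atoms a disjoint sequence without further choices.
  Each count of an \<open>E i\<close> is then a sum of counts of atoms, hence independent of the count of \<open>F\<close>.
\<close>
lemma cylinder_indep:
  assumes a: "a \<le> T" and A: "A \<in> cylinders a" and F: "boxed F" "F \<subseteq> {a<..} \<times> UNIV"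
    and C: "C \<in> sets borel"
  shows "prob (A \<inter> {\<omega>\<in>space M. emeasure (N \<omega>) F \<in> C}) = prob A * prob {\<omega>\<in>space M. emeasure (N \<omega>) F \<in> C}"
proof -
  obtain n E B where
    A: "A = {\<omega>\<in>space M. \<forall>i<n. emeasure (N \<omega>) (E i) \<in> B i}"
       "\<And>i::nat. E i \<in> sets borel" "\<And>i. E i \<subseteq> strip a" "\<And>i. B i \<in> sets borel"
    using A unfolding cylinders_def by blast
  note [measurable] = A(2,4) C
  define atom where "atom = (\<lambda>j. {x\<in>strip a. j = set_encode {i. i < n \<and> x \<in> E i}})"
  have fin: "finite {i. i < n \<and> x \<in> E i}" for x by simp
  have atom_eq: "atom j = {x\<in>strip a. \<forall>i. i \<in> set_decode j \<longleftrightarrow> i < n \<and> x \<in> E i}" for j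
  proof -
    have "j = set_encode {i. i < n \<and> x \<in> E i} \<longleftrightarrow> set_decode j = {i. i < n \<and> x \<in> E i}" for x
      using set_encode_inverse[OF fin] set_decode_inverse[of j] by metis
    then show ?thesis unfolding atom_def by (simp add: set_eq_iff)
  qed
  have atom_borel: "atom j \<in> sets borel" for j
    unfolding atom_eq by measurable
  \<comment> \<open>One disjoint sequence contains both the future set, at index 0, and all atoms of the past.\<close>
  define G where "G = (\<lambda>k::nat. case k of 0 \<Rightarrow> F | Suc j \<Rightarrow> atom j)"
  have strip_sub: "strip a \<subseteq> strip T" using a by (auto simp: strip_def)
  have "range G \<subseteq> sets (strip_lebesgue T)"
    using atom_borel F(1) strip_sub
    by (auto simp: G_def sets_strip_lebesgue boxed_def atom_def split: nat.splits)
  moreover have "disjoint_family G"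
    using F(2) by (auto simp: disjoint_family_on_def G_def atom_def strip_def split: nat.splits)
  ultimately have "indep_vars (\<lambda>_. borel) (\<lambda>i \<omega>. emeasure (N \<omega>) (G i)) (UNIV :: nat set)"
    by (rule indep_counts)
  then have ind: "indep_var
      (PiM {1..} (\<lambda>_. borel)) (\<lambda>\<omega>. restrict (\<lambda>i. emeasure (N \<omega>) (G i)) {1..})
      (PiM {0} (\<lambda>_. borel)) (\<lambda>\<omega>. restrict (\<lambda>i. emeasure (N \<omega>) (G i)) {0})"
    by (rule indep_var_restrict) auto
  \<comment> \<open>\<open>S i\<close> recovers the count of \<open>E i\<close> from the counts of the atoms.\<close>
  define S where "S = (\<lambda>i y. \<Sum>j. if i \<in> set_decode j then y (Suc j) else (0::ennreal))"
  have S_meas: "S i \<in> borel_measurable (PiM {1..} (\<lambda>_. borel))" for i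
    unfolding S_def by measurable
  have S_eq: "S i (restrict (\<lambda>i. emeasure (N \<omega>) (G i)) {1..}) = emeasure (N \<omega>) (E i)"
    if "\<omega> \<in> space M" "i < n" for i \<omega>
  proof -
    have "(\<Union>j. if i \<in> set_decode j then atom j else {}) = E i"
    proof safe
      fix x j assume "x \<in> (if i \<in> set_decode j then atom j else {})"
      then show "x \<in> E i" using that by (auto simp: atom_eq split: if_splits)
    next
      fix x assume "x \<in> E i"
      then have "x \<in> (if i \<in> set_decode (set_encode {i. i < n \<and> x \<in> E i}) then atom (set_encode {i. i < n \<and> x \<in> E i}) else {})"
        using that A(3) set_encode_inverse[OF fin, of x] by (auto simp: atom_def)
      then show "x \<in> (\<Union>j. if i \<in> set_decode j then atom j else {})" by blast
    qed
    moreover have "(\<Sum>j. emeasure (N \<omega>) (if i \<in> set_decode j then atom j else {}))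
      = emeasure (N \<omega>) (\<Union>j. if i \<in> set_decode j then atom j else {})"
      using that strip_sub atom_borel
      by (intro suminf_emeasure) (auto simp: disjoint_family_on_def atom_def sets_N)
    moreover have "(\<lambda>j. emeasure (N \<omega>) (if i \<in> set_decode j then atom j else {}))
      = (\<lambda>j. if i \<in> set_decode j then emeasure (N \<omega>) (atom j) else 0)"
      by auto
    ultimately show ?thesis unfolding S_def G_def
      by (simp cong: if_cong)
  qed
  define Xa where "Xa = {y\<in>space (PiM {1..} (\<lambda>_. borel)). \<forall>i<n. S i y \<in> B i}"
  define Xb where "Xb = {y\<in>space (PiM {0::nat} (\<lambda>_. borel :: ennreal measure)). y 0 \<in> C}"
  have Xa: "Xa \<in> sets (PiM {1..} (\<lambda>_. borel))"
    unfolding Xa_def using S_meas by measurable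
  have Xb: "Xb \<in> sets (PiM {0} (\<lambda>_. borel))"
    unfolding Xb_def by measurable
  have inA: "restrict (\<lambda>i. emeasure (N \<omega>) (G i)) {1..} \<in> Xa \<longleftrightarrow> \<omega> \<in> A" if "\<omega> \<in> space M" for \<omega>
    using that S_eq[OF that] by (auto simp: Xa_def A(1) space_PiM)
  have inB: "restrict (\<lambda>i. emeasure (N \<omega>) (G i)) {0} \<in> Xb \<longleftrightarrow> emeasure (N \<omega>) F \<in> C" if "\<omega> \<in> space M" for \<omega>
    by (auto simp: Xb_def space_PiM G_def)
  have AM: "A \<subseteq> space M" unfolding A by auto
  have eA: "(\<lambda>\<omega>. restrict (\<lambda>i. emeasure (N \<omega>) (G i)) {1..}) -` Xa \<inter> space M = A"
    using inA AM by auto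
  have eB: "(\<lambda>\<omega>. restrict (\<lambda>i. emeasure (N \<omega>) (G i)) {0}) -` Xb \<inter> space M = {\<omega>\<in>space M. emeasure (N \<omega>) F \<in> C}"
    using inB by auto
  have "(\<lambda>\<omega>. (restrict (\<lambda>i. emeasure (N \<omega>) (G i)) {1..}, restrict (\<lambda>i. emeasure (N \<omega>) (G i)) {0})) -` (Xa \<times> Xb) \<inter> space M
    = A \<inter> {\<omega>\<in>space M. emeasure (N \<omega>) F \<in> C}"
    using eA eB by blast
  with indep_varD[OF ind Xa Xb] eA eB show ?thesis by simp
qed

text \<open>Both the cylinders and the events of a single count are intersection-stable generators, so
  independence passes to the generated sigma-algebras.\<close>
lemma history_indep:
  assumes a: "a \<le> T" and A: "A \<in> sets (history M N a)" and F: "boxed F" "F \<subseteq> {a<..} \<times> UNIV"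
    and C: "C \<in> sets borel"
  shows "prob (A \<inter> {\<omega>\<in>space M. emeasure (N \<omega>) F \<in> C}) = prob A * prob {\<omega>\<in>space M. emeasure (N \<omega>) F \<in> C}"
proof -
  define K where "K = {{\<omega>\<in>space M. emeasure (N \<omega>) F \<in> C} | C. C \<in> sets borel}"
  have gen: "{(\<lambda>\<omega>. emeasure (N \<omega>) F) -` B \<inter> space M | F B. F \<in> sets borel \<and> F \<subseteq> strip a \<and> B \<in> sets borel} \<subseteq> cylinders a"
  proof clarify
    fix F and B :: "ennreal set" assume "F \<in> sets borel" "F \<subseteq> strip a" "B \<in> sets borel"
    then show "(\<lambda>\<omega>. emeasure (N \<omega>) F) -` B \<inter> space M \<in> cylinders a"
      unfolding cylinders_def
      by (intro CollectI exI[of _ "1::nat"] exI[of _ "\<lambda>_. F"] exI[of _ "\<lambda>_. B"]) auto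
  qed
  have "indep_set (cylinders a) K"
  proof (rule indep_setI)
    show "cylinders a \<subseteq> events"
    proof
      fix A assume "A \<in> cylinders a"
      then obtain n E B where
        A: "A = {\<omega>\<in>space M. \<forall>i<n. emeasure (N \<omega>) (E i) \<in> B i}"
           "\<And>i::nat. E i \<in> sets borel" "\<And>i. E i \<subseteq> strip a" "\<And>i. B i \<in> sets borel"
        unfolding cylinders_def by blast
      have "E i \<in> sets (strip_lebesgue T)" for i
        using A(2,3)[of i] a by (auto simp: sets_strip_lebesgue strip_def)
      then have [measurable]: "(\<lambda>\<omega>. emeasure (N \<omega>) (E i)) \<in> borel_measurable M" for i
        using measurable_count by blast
      note [measurable] = A(4)
      show "A \<in> events" unfolding A(1) by measurable
    qed
    have [measurable]: "(\<lambda>\<omega>. emeasure (N \<omega>) F) \<in> borel_measurable M"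
      by (rule measurable_count[OF boxedD[OF F(1)]])
    show "K \<subseteq> events" unfolding K_def by auto
  qed (auto simp: K_def intro!: cylinder_indep[OF a _ F])
  moreover have "Int_stable K"
  proof (rule Int_stableI)
    fix x y assume "x \<in> K" "y \<in> K"
    then obtain C D where "x = {\<omega>\<in>space M. emeasure (N \<omega>) F \<in> C}" "C \<in> sets borel"
      "y = {\<omega>\<in>space M. emeasure (N \<omega>) F \<in> D}" "D \<in> sets borel" unfolding K_def by blast
    then show "x \<inter> y \<in> K" unfolding K_def by (intro CollectI exI[of _ "C \<inter> D"]) auto
  qed
  ultimately have "indep_set (sigma_sets (space M) (cylinders a)) (sigma_sets (space M) K)"
    using cylinders_Int_stable by (intro indep_set_sigma_sets)
  moreover have "A \<in> sigma_sets (space M) (cylinders a)"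
    using A sigma_sets_mono'[OF gen] unfolding sets_history by blast
  moreover have "{\<omega>\<in>space M. emeasure (N \<omega>) F \<in> C} \<in> sigma_sets (space M) K"
    using C by (intro sigma_sets.Basic) (auto simp: K_def)
  ultimately show ?thesis by (rule indep_setD)
qed

lemma nn_integral_count_history:
  assumes a: "a \<le> T" and A: "A \<in> sets (history M N a)" and F: "boxed F" "F \<subseteq> {a<..} \<times> UNIV"
  shows "(\<integral>\<^sup>+\<omega>. of_nat (count F \<omega>) * indicator A \<omega> \<partial>M) = emeasure M A * emeasure lborel F"
proof -
  note [measurable] = count_measurable[OF F(1)]
  have AM: "A \<in> sets M" using A history_subset[OF a] by blast
  have eq: "{\<omega>\<in>space M. count F \<omega> = n} = {\<omega>\<in>space M. emeasure (N \<omega>) F \<in> {of_nat n}}" for n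
    using emeasure_N[OF _ F(1)] by auto
  have p: "emeasure M (A \<inter> {\<omega>\<in>space M. count F \<omega> = n}) = emeasure M A *
      ennreal (measure lborel F ^ n / fact n * exp (- measure lborel F))" for n
  proof -
    have "prob (A \<inter> {\<omega>\<in>space M. count F \<omega> = n}) = prob A * prob {\<omega>\<in>space M. count F \<omega> = n}"
      unfolding eq by (rule history_indep[OF a A F]) simp
    then show ?thesis
      unfolding emeasure_eq_measure prob_count[OF F(1)] by (simp add: ennreal_mult[symmetric])
  qed
  have "(\<integral>\<^sup>+\<omega>. of_nat (count F \<omega>) * indicator A \<omega> \<partial>M)
    = (\<Sum>n. of_nat n * emeasure M (A \<inter> {\<omega>\<in>space M. count F \<omega> = n}))"
    using AM by (intro nn_integral_nat_valued) auto
  also have "\<dots> = (\<Sum>n. emeasure M A * (of_nat n *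
      ennreal (measure lborel F ^ n / fact n * exp (- measure lborel F))))"
    by (simp add: p mult_ac)
  also have "\<dots> = emeasure M A * (\<Sum>n. of_nat n *
      ennreal (measure lborel F ^ n / fact n * exp (- measure lborel F)))"
    by simp
  also have "(\<Sum>n. of_nat n * ennreal (measure lborel F ^ n / fact n * exp (- measure lborel F))) = ennreal (measure lborel F)"
    using suminf_of_nat_ennreal[of "\<lambda>n. n", OF poisson_mean[of "measure lborel F"]] by simp
  finally show ?thesis using emeasure_boxed[OF F(1)] by simp
qed

text \<open>
  Replaces the open condition \<open>a < s\<close> by \<open>a \<le> s\<close>: a vertical line has area 0, so it
  almost surely carries no point. This is needed because the history at time \<open>a\<close> includes the line over
  \<open>a\<close>, while the counting process counts the points with \<open>a \<le> s < b\<close>.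
\<close>
lemma nn_integral_emeasure_history:
  assumes a: "a \<le> T" and A: "A \<in> sets (history M N a)" and F: "boxed F" "F \<subseteq> {a..} \<times> UNIV"
  shows "(\<integral>\<^sup>+\<omega>. emeasure (N \<omega>) F * indicator A \<omega> \<partial>M) = emeasure lborel F * emeasure M A"
proof -
  let ?G = "F \<inter> {a<..} \<times> UNIV" and ?L = "F \<inter> {a} \<times> UNIV"
  have bG: "?G \<in> sets borel" and bL: "?L \<in> sets borel"
    using F(1) by (auto simp: boxed_def open_Times closed_Times)
  have G: "boxed ?G" "boxed ?L"
    using F(1) bG bL by (auto intro: boxed_subset)
  have FGL: "F = ?G \<union> ?L" using F(2) by auto
  note [measurable] = count_measurable[OF F(1)] count_measurable[OF G(1)] count_measurable[OF G(2)]
  have AM [measurable]: "A \<in> sets M" using A history_subset[OF a] by blast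
  have L0: "emeasure lborel ?L = 0" by (rule emeasure_vertical_line)
  have eG: "emeasure lborel F = emeasure lborel ?G"
  proof -
    have "emeasure lborel F = emeasure lborel ?G + emeasure lborel ?L"
      by (subst FGL, rule plus_emeasure[symmetric]) (use bG bL in auto)
    then show ?thesis using L0 by simp
  qed
  have "(\<integral>\<^sup>+\<omega>. of_nat (count ?L \<omega>) * indicator A \<omega> \<partial>M) \<le> (\<integral>\<^sup>+\<omega>. of_nat (count ?L \<omega>) \<partial>M)"
    by (intro nn_integral_mono) (auto simp: indicator_def)
  then have L0': "(\<integral>\<^sup>+\<omega>. of_nat (count ?L \<omega>) * indicator A \<omega> \<partial>M) = 0"
    using nn_integral_count[OF G(2)] L0 by simp
  have "(\<integral>\<^sup>+\<omega>. emeasure (N \<omega>) F * indicator A \<omega> \<partial>M)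
    = (\<integral>\<^sup>+\<omega>. of_nat (count ?G \<omega>) * indicator A \<omega> + of_nat (count ?L \<omega>) * indicator A \<omega> \<partial>M)"
  proof (rule nn_integral_cong)
    fix \<omega> assume w: "\<omega> \<in> space M"
    have "count F \<omega> = count ?G \<omega> + count ?L \<omega>"
      by (subst FGL, rule count_Un[OF w G]) auto
    then show "emeasure (N \<omega>) F * indicator A \<omega> = of_nat (count ?G \<omega>) * indicator A \<omega> + of_nat (count ?L \<omega>) * indicator A \<omega>"
      using emeasure_N[OF w F(1)] by (simp add: distrib_right)
  qed
  also have "\<dots> = (\<integral>\<^sup>+\<omega>. of_nat (count ?G \<omega>) * indicator A \<omega> \<partial>M)"
    by (subst nn_integral_add) (auto simp: L0')
  also have "\<dots> = emeasure M A * emeasure lborel ?G"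
    by (rule nn_integral_count_history[OF a A G(1)]) auto
  finally show ?thesis using eG by (simp add: mult.commute)
qed

lemma emeasure_N_history:
  assumes "boxed F" "F \<subseteq> strip a"
  shows "(\<lambda>\<omega>. emeasure (N \<omega>) F) \<in> borel_measurable (history M N a)"
    using assms by (intro measurableI) (auto simp: sets_history boxed_def intro!: sigma_sets.Basic)

section \<open>Predictable regions\<close>

text \<open>
  The rectangles that define the predictable sigma-algebra do not meet time 0. Adding the set
  \<open>{0} \<times> \<Omega>\<close> leaves the sigma-algebra unchanged and makes the generator cover
  the whole space, as is required for generating a product sigma-algebra by boxes.
\<close>
definition pred_rects :: "(real \<times> 'a) set set" where
  "pred_rects = {{s<..t} \<times> A | s t A. 0 \<le> s \<and> s \<le> t \<and> t \<le> T \<and> A \<in> sets (history M N s)}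
     \<union> {{0} \<times> space M}"

lemma history_into_space: "A \<in> sets (history M N s) \<Longrightarrow> A \<subseteq> space M"
  using sets.sets_into_space[of A "history M N s"] by simp

lemma space_predictable [simp]: "space (predictable_sigma T M N) = {0..T} \<times> space M"
  unfolding predictable_sigma_def by (rule space_measure_of) (use history_into_space in force)

lemma sets_predictable: "sets (predictable_sigma T M N) = sigma_sets ({0..T} \<times> space M)
   {{s<..t} \<times> A | s t A. 0 \<le> s \<and> s \<le> t \<and> t \<le> T \<and> A \<in> sets (history M N s)}"
  unfolding predictable_sigma_def by (rule sets_measure_of) (use history_into_space in force)

lemma rect_predictable:
  "0 \<le> s \<Longrightarrow> s \<le> t \<Longrightarrow> t \<le> T \<Longrightarrow> A \<in> sets (history M N s) \<Longrightarrow> {s<..t} \<times> A \<in> sets (predictable_sigma T M N)"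
  unfolding sets_predictable by (intro sigma_sets.Basic) auto

lemma pred_rects_subset: "pred_rects \<subseteq> Pow ({0..T} \<times> space M)"
  unfolding pred_rects_def using history_into_space T_pos by fastforce

lemma sets_predictable_rects:
  "sets (predictable_sigma T M N) = sets (sigma ({0..T} \<times> space M) pred_rects)"
proof -
  have sp: "space M \<in> sets (history M N 0)"
    using sets.top[of "history M N 0"] by simp
  have "{0} \<times> space M = ({0..T} \<times> space M) - {0<..T} \<times> space M"
    using T_pos by auto
  also have "\<dots> \<in> sets (predictable_sigma T M N)"
    using rect_predictable[OF _ _ _ sp, of T] T_pos sets.top[of "predictable_sigma T M N"] by auto
  finally have "pred_rects \<subseteq> sets (predictable_sigma T M N)"
    unfolding pred_rects_def using rect_predictable by auto
  then have "sigma_sets ({0..T} \<times> space M) pred_rects \<subseteq> sets (predictable_sigma T M N)"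
    using sets.sigma_sets_subset[of pred_rects "predictable_sigma T M N"] by simp
  moreover have "sets (predictable_sigma T M N) \<subseteq> sigma_sets ({0..T} \<times> space M) pred_rects"
    unfolding sets_predictable by (intro sigma_sets_mono') (auto simp: pred_rects_def)
  ultimately show ?thesis
    by (subst sets_measure_of[OF pred_rects_subset]) auto
qed

definition pred_boxes :: "((real \<times> 'a) \<times> real) set set" where
  "pred_boxes = {R \<times> B | R B. R \<in> pred_rects \<and> B \<in> sets borel}"

lemma pred_boxes_subset: "pred_boxes \<subseteq> Pow (({0..T} \<times> space M) \<times> UNIV)"
  unfolding pred_boxes_def using pred_rects_subset by blast

lemma pred_rects_Int: "R \<in> pred_rects \<Longrightarrow> R' \<in> pred_rects \<Longrightarrow> R \<inter> R' \<in> pred_rects"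
proof -
  have rr: "({s<..t} \<times> A) \<inter> ({s'<..t'} \<times> A') \<in> pred_rects"
    if "0 \<le> s" "s \<le> t" "t \<le> T" "A \<in> sets (history M N s)"
       "0 \<le> s'" "s' \<le> t'" "t' \<le> T" "A' \<in> sets (history M N s')" for s t A s' t' A'
  proof -
    have "A \<in> sets (history M N (max s s'))" "A' \<in> sets (history M N (max s s'))"
      using that history_mono[of s "max s s'"] history_mono[of s' "max s s'"] by auto
    then have "A \<inter> A' \<in> sets (history M N (max s s'))" by auto
    moreover have "({s<..t} \<times> A) \<inter> ({s'<..t'} \<times> A') = {max s s'<..max (max s s') (min t t')} \<times> (A \<inter> A')"
      by auto
    moreover have "0 \<le> max s s'" "max s s' \<le> max (max s s') (min t t')" "max (max s s') (min t t') \<le> T"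
      using that by auto
    ultimately show ?thesis unfolding pred_rects_def by blast
  qed
  have e: "{} \<in> pred_rects"
  proof -
    have "{0<..0} \<times> {} \<in> pred_rects" unfolding pred_rects_def using T_pos by fastforce
    then show ?thesis by simp
  qed
  have rz: "({s<..t} \<times> A) \<inter> ({0} \<times> space M) = {}" "({0} \<times> space M) \<inter> ({s<..t} \<times> A) = {}" if "0 \<le> s" for s t :: real and A :: "'a set"
    using that by auto
  have zz: "{0} \<times> space M \<in> pred_rects" unfolding pred_rects_def by blast
  assume "R \<in> pred_rects" "R' \<in> pred_rects"
  then show "R \<inter> R' \<in> pred_rects"
    unfolding pred_rects_def[THEN eqset_imp_iff, of R] pred_rects_def[THEN eqset_imp_iff, of R']
    using rr e zz by (elim UnE CollectE exE conjE singletonE) (simp_all only: rz Int_absorb)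
qed

lemma pred_boxes_Int_stable: "Int_stable pred_boxes"
proof (rule Int_stableI)
  fix x y assume "x \<in> pred_boxes" "y \<in> pred_boxes"
  then obtain R B R' B' where "x = R \<times> B" "y = R' \<times> B'" "R \<in> pred_rects" "R' \<in> pred_rects"
    "B \<in> sets borel" "B' \<in> sets borel" unfolding pred_boxes_def by blast
  then show "x \<inter> y \<in> pred_boxes"
    unfolding pred_boxes_def
    by (intro CollectI exI[of _ "R \<inter> R'"] exI[of _ "B \<inter> B'"]) (auto intro: pred_rects_Int)
qed

lemma sets_predictable_pair:
  "sets (predictable_sigma T M N \<Otimes>\<^sub>M borel) = sigma_sets (({0..T} \<times> space M) \<times> UNIV) pred_boxes"
proof -
  have "sets (predictable_sigma T M N \<Otimes>\<^sub>M (borel :: real measure))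
     = sets (sigma ({0..T} \<times> space M) pred_rects \<Otimes>\<^sub>M sigma UNIV (sets (borel :: real measure)))"
    by (intro sets_pair_measure_cong sets_predictable_rects) (metis sets.sets_measure_of_eq space_borel)
  also have "sigma ({0..T} \<times> space M) pred_rects \<Otimes>\<^sub>M sigma UNIV (sets (borel :: real measure))
    = sigma (({0..T} \<times> space M) \<times> UNIV) {a \<times> b | a b. a \<in> pred_rects \<and> b \<in> sets borel}"
  proof (rule sigma_prod)
    have "space M \<in> sets (history M N 0)"
      using sets.top[of "history M N 0"] by simp
    then have "{0<..T} \<times> space M \<in> pred_rects" "{0} \<times> space M \<in> pred_rects"
      unfolding pred_rects_def using T_pos by fastforce+
    moreover have "{0..T} \<times> space M = \<Union>{{0<..T} \<times> space M, {0} \<times> space M}"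
      using T_pos by auto
    ultimately show "\<exists>E\<subseteq>pred_rects. countable E \<and> {0..T} \<times> space M = \<Union>E"
      by (intro exI[of _ "{{0<..T} \<times> space M, {0} \<times> space M}"]) auto
    show "\<exists>E\<subseteq>sets borel. countable E \<and> UNIV = \<Union> E"
      by (intro exI[of _ "{UNIV}"]) auto
  qed (use pred_rects_subset in auto)
  finally show ?thesis
    using pred_boxes_subset by (simp add: pred_boxes_def)
qed

text \<open>
  A slab of time width \<open>b - a\<close> below the level \<open>C\<close>. The half-open time interval matches the
  strict inequality \<open>s < t\<close> in the counting process and makes consecutive slabs disjoint.
\<close>
definition slab :: "real \<Rightarrow> real \<Rightarrow> real \<Rightarrow> (real \<times> real) set" where
  "slab a b C = {a..<b} \<times> {0..C}"

lemma slab_boxed: "0 \<le> a \<Longrightarrow> b \<le> T \<Longrightarrow> boxed (slab a b C)"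
proof -
  assume "0 \<le> a" "b \<le> T"
  moreover have "bounded (slab a b C)"
    by (rule bounded_subset[of "{a..b} \<times> {0..C}"])
      (auto simp: slab_def intro!: bounded_Times bounded_closed_interval)
  moreover have "slab a b C \<in> sets borel"
    unfolding slab_def borel_prod[symmetric] by auto
  ultimately show ?thesis by (auto simp: boxed_def slab_def strip_def)
qed

definition section_at :: "((real \<times> 'a) \<times> real) set \<Rightarrow> 'a \<Rightarrow> (real \<times> real) set" where
  "section_at H \<omega> = {(s, u). ((s, \<omega>), u) \<in> H}"

text \<open>
  Campbell's formula, conditionally on the history at time \<open>a\<close>: the mean number of points in a random region with predictable graph
  equals its mean area. For a box with base \<open>(s, t] \<times> A'\<close> this is the independence
  of \<open>A \<inter> A'\<close>, which lies in the history at the later of the times \<open>a\<close> and \<open>s\<close>, from the points after that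
  time. The general case is a Dynkin class argument, and measurability of the
  sections is carried along because complements and unions need it for their integrals.
  Intersecting with a slab keeps all masses finite, so that complements can be subtracted.
\<close>
lemma campbell_predictable:
  assumes ab: "0 \<le> a" "a \<le> b" "b \<le> T"
    and H: "H \<in> sets (predictable_sigma T M N \<Otimes>\<^sub>M borel)"
  shows "(\<forall>\<omega>\<in>space M. slab a b C \<inter> section_at H \<omega> \<in> sets borel) \<and>
    (\<lambda>\<omega>. emeasure (N \<omega>) (slab a b C \<inter> section_at H \<omega>)) \<in> borel_measurable (history M N b) \<and>
    (\<lambda>\<omega>. emeasure lborel (slab a b C \<inter> section_at H \<omega>)) \<in> borel_measurable M \<and>
    (\<forall>A\<in>sets (history M N a).
      (\<integral>\<^sup>+\<omega>. emeasure (N \<omega>) (slab a b C \<inter> section_at H \<omega>) * indicator A \<omega> \<partial>M)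
      = (\<integral>\<^sup>+\<omega>. emeasure lborel (slab a b C \<inter> section_at H \<omega>) * indicator A \<omega> \<partial>M))"
  (is "?P H")
proof -
  let ?S = "slab a b C"
  have boxS: "boxed ?S" using ab by (intro slab_boxed) auto
  have Sb: "?S \<subseteq> strip b" "?S \<subseteq> {a..} \<times> UNIV" "?S \<subseteq> {0..T} \<times> UNIV"
    using ab by (auto simp: slab_def strip_def)
  have subM: "history M N b \<rightarrow>\<^sub>M borel \<subseteq> (borel_measurable M :: ('a \<Rightarrow> ennreal) set)"
  proof
    fix f :: "'a \<Rightarrow> ennreal" assume "f \<in> history M N b \<rightarrow>\<^sub>M borel"
    then show "f \<in> borel_measurable M"
      using history_subset[of b] ab by (auto simp: measurable_def)
  qed
  have NS: "(\<lambda>\<omega>. emeasure (N \<omega>) ?S) \<in> borel_measurable (history M N b)"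
    by (rule emeasure_N_history[OF boxS Sb(1)])
  \<comment> \<open>A box has sections \<open>F\<close> on the event \<open>A'\<close> and empty sections elsewhere. The time \<open>m\<close> separates the
    event, which is known at \<open>m\<close>, from the points of \<open>F\<close>, which come at \<open>m\<close> or later.\<close>
  have base: "?P H" if sec: "\<And>\<omega>. \<omega> \<in> space M \<Longrightarrow> ?S \<inter> section_at H \<omega> = (if \<omega> \<in> A' then F else {})"
    and F: "F \<subseteq> ?S" "F \<in> sets borel" and A'b: "F \<noteq> {} \<Longrightarrow> A' \<in> sets (history M N b)"
    and m: "a \<le> m" "m \<le> T" "F \<subseteq> {m..} \<times> UNIV" "A' \<in> sets (history M N m)" for H A' F m
  proof (intro conjI ballI)
    fix \<omega> assume "\<omega> \<in> space M" then show "?S \<inter> section_at H \<omega> \<in> sets borel" using sec F by simp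
  next
    have F': "boxed F" using boxed_subset[OF boxS F] .
    have A'M: "A' \<in> sets M" using m(2,4) history_subset by blast
    show "(\<lambda>\<omega>. emeasure (N \<omega>) (?S \<inter> section_at H \<omega>)) \<in> borel_measurable (history M N b)"
    proof (cases "F = {}")
      case True
      then show ?thesis using sec by (subst measurable_cong[where g="\<lambda>_. 0"]) auto
    next
      case False
      have [measurable]: "A' \<in> sets (history M N b)" by (rule A'b[OF False])
      have [measurable]: "(\<lambda>\<omega>. emeasure (N \<omega>) F) \<in> borel_measurable (history M N b)"
        using F(1) Sb(1) by (intro emeasure_N_history[OF F']) auto
      show ?thesis
        by (subst measurable_cong[where g="\<lambda>\<omega>. emeasure (N \<omega>) F * indicator A' \<omega>"])
          (auto simp: sec)
    qed
    show "(\<lambda>\<omega>. emeasure lborel (?S \<inter> section_at H \<omega>)) \<in> borel_measurable M"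
      using A'M by (subst measurable_cong[where g="\<lambda>\<omega>. emeasure lborel F * indicator A' \<omega>"])
          (auto simp: sec)
    fix A assume A: "A \<in> sets (history M N a)"
    have AA: "A \<inter> A' \<in> sets (history M N m)" using A m(4) history_mono[OF m(1)] by blast
    then have AAM: "A \<inter> A' \<in> sets M" using m(2) history_subset by blast
    have "(\<integral>\<^sup>+\<omega>. emeasure (N \<omega>) (?S \<inter> section_at H \<omega>) * indicator A \<omega> \<partial>M)
      = (\<integral>\<^sup>+\<omega>. emeasure (N \<omega>) F * indicator (A \<inter> A') \<omega> \<partial>M)"
      by (intro nn_integral_cong) (auto simp: sec indicator_def)
    also have "\<dots> = emeasure lborel F * emeasure M (A \<inter> A')"
      by (rule nn_integral_emeasure_history[OF m(2) AA F' m(3)])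
    also have "\<dots> = (\<integral>\<^sup>+\<omega>. emeasure lborel F * indicator (A \<inter> A') \<omega> \<partial>M)"
      using AAM by (simp add: nn_integral_cmult_indicator)
    also have "\<dots> = (\<integral>\<^sup>+\<omega>. emeasure lborel (?S \<inter> section_at H \<omega>) * indicator A \<omega> \<partial>M)"
      by (intro nn_integral_cong) (auto simp: sec indicator_def)
    finally show "(\<integral>\<^sup>+\<omega>. emeasure (N \<omega>) (?S \<inter> section_at H \<omega>) * indicator A \<omega> \<partial>M)
      = (\<integral>\<^sup>+\<omega>. emeasure lborel (?S \<inter> section_at H \<omega>) * indicator A \<omega> \<partial>M)" .
  qed
  show "?P H"
    using pred_boxes_Int_stable pred_boxes_subset H[unfolded sets_predictable_pair]
  proof (induction H rule: sigma_sets_induct_disjoint)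
    case (basic H)
    then obtain R B where R: "H = R \<times> B" "R \<in> pred_rects" "B \<in> sets borel"
      unfolding pred_boxes_def by blast
    from R(2) consider (rect) s t A' where "R = {s<..t} \<times> A'" "0 \<le> s" "s \<le> t" "t \<le> T" "A' \<in> sets (history M N s)"
      | (zero) "R = {0} \<times> space M"
      unfolding pred_rects_def by blast
    then show ?case
    proof cases
      case rect
      let ?F = "({s<..t} \<inter> {a..<b}) \<times> (B \<inter> {0..C})"
      show ?thesis
      proof (rule base)
        show "?S \<inter> section_at H \<omega> = (if \<omega> \<in> A' then ?F else {})" for \<omega>
          unfolding R(1) rect section_at_def slab_def by auto
        show "?F \<in> sets borel" unfolding borel_prod[symmetric] using R(3) by auto
        show "A' \<in> sets (history M N b)" if "?F \<noteq> {}"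
          using that rect(5) history_mono[of s b] by auto
        show "A' \<in> sets (history M N (max s a))" using rect(5) history_mono[of s "max s a"] by auto
      qed (use rect ab in \<open>auto simp: slab_def\<close>)
    next
      case zero
      let ?F = "({0} \<inter> {a..<b}) \<times> (B \<inter> {0..C})"
      show ?thesis
      proof (rule base)
        show "?S \<inter> section_at H \<omega> = (if \<omega> \<in> space M then ?F else {})" for \<omega>
          unfolding R(1) zero section_at_def slab_def by auto
        show "?F \<in> sets borel" unfolding borel_prod[symmetric] using R(3) by auto
        show "space M \<in> sets (history M N b)" "space M \<in> sets (history M N a)"
          using sets.top[of "history M N b"] sets.top[of "history M N a"] by auto
      qed (use ab in \<open>auto simp: slab_def\<close>)
    qed
  next
    case empty
    then show ?case by (simp add: section_at_def)
  next
    case (compl H)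
    note IH = compl.IH
    have sec: "?S \<inter> section_at (({0..T} \<times> space M) \<times> UNIV - H) \<omega> = ?S - (?S \<inter> section_at H \<omega>)"
      if "\<omega> \<in> space M" for \<omega>
      using that Sb(3) by (auto simp: section_at_def)
    have box: "boxed (?S \<inter> section_at H \<omega>)" if "\<omega> \<in> space M" for \<omega>
      using IH that by (intro boxed_subset[OF boxS]) auto
    have eN: "emeasure (N \<omega>) (?S \<inter> section_at (({0..T} \<times> space M) \<times> UNIV - H) \<omega>)
       = emeasure (N \<omega>) ?S - emeasure (N \<omega>) (?S \<inter> section_at H \<omega>)" if "\<omega> \<in> space M" for \<omega>
      unfolding sec[OF that]
      using that box[OF that] boxS
      by (intro emeasure_Diff) (auto simp: sets_N emeasure_N boxed_def)
    have eL: "emeasure lborel (?S \<inter> section_at (({0..T} \<times> space M) \<times> UNIV - H) \<omega>)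
       = emeasure lborel ?S - emeasure lborel (?S \<inter> section_at H \<omega>)" if "\<omega> \<in> space M" for \<omega>
      unfolding sec[OF that]
      using that box[OF that] boxS emeasure_boxed[OF box[OF that]]
      by (intro emeasure_Diff) (auto simp: boxed_def)
    have mN: "(\<lambda>\<omega>. emeasure (N \<omega>) (?S \<inter> section_at H \<omega>)) \<in> borel_measurable (history M N b)"
      and mL [measurable]: "(\<lambda>\<omega>. emeasure lborel (?S \<inter> section_at H \<omega>)) \<in> borel_measurable M" using IH by auto
    have mN' [measurable]: "(\<lambda>\<omega>. emeasure (N \<omega>) (?S \<inter> section_at H \<omega>)) \<in> borel_measurable M"
       "(\<lambda>\<omega>. emeasure (N \<omega>) ?S) \<in> borel_measurable M"
      using mN NS subM by auto
    show ?case
    proof (intro conjI ballI)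
      fix \<omega> assume "\<omega> \<in> space M"
      then show "?S \<inter> section_at (({0..T} \<times> space M) \<times> UNIV - H) \<omega> \<in> sets borel"
        using sec box boxS by (auto simp: boxed_def)
    next
      show "(\<lambda>\<omega>. emeasure (N \<omega>) (?S \<inter> section_at (({0..T} \<times> space M) \<times> UNIV - H) \<omega>)) \<in> borel_measurable (history M N b)"
        using mN NS by (subst measurable_cong[OF eN]) auto
      show "(\<lambda>\<omega>. emeasure lborel (?S \<inter> section_at (({0..T} \<times> space M) \<times> UNIV - H) \<omega>)) \<in> borel_measurable M"
        using mL by (subst measurable_cong[OF eL]) auto
      fix A assume A: "A \<in> sets (history M N a)"
      then have AM [measurable]: "A \<in> sets M" using history_subset[of a] ab by auto
      have S_eq: "(\<integral>\<^sup>+\<omega>. emeasure (N \<omega>) ?S * indicator A \<omega> \<partial>M) = emeasure lborel ?S * emeasure M A"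
        using ab by (intro nn_integral_emeasure_history[of a] A boxS Sb(2)) auto
      have IHA: "(\<integral>\<^sup>+\<omega>. emeasure (N \<omega>) (?S \<inter> section_at H \<omega>) * indicator A \<omega> \<partial>M)
        = (\<integral>\<^sup>+\<omega>. emeasure lborel (?S \<inter> section_at H \<omega>) * indicator A \<omega> \<partial>M)" using IH A by blast
      have leN: "emeasure (N \<omega>) (?S \<inter> section_at H \<omega>) \<le> emeasure (N \<omega>) ?S" if "\<omega> \<in> space M" for \<omega>
        using that boxS by (intro emeasure_mono) (auto simp: sets_N boxed_def)
      have leL: "emeasure lborel (?S \<inter> section_at H \<omega>) \<le> emeasure lborel ?S" for \<omega>
        using boxS by (intro emeasure_mono) (auto simp: boxed_def)
      have fin: "emeasure lborel ?S * emeasure M A \<noteq> \<infinity>"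
        using emeasure_boxed[OF boxS] by (simp add: emeasure_eq_measure ennreal_mult[symmetric])
      have "(\<integral>\<^sup>+\<omega>. emeasure (N \<omega>) (?S \<inter> section_at H \<omega>) * indicator A \<omega> \<partial>M) \<le> (\<integral>\<^sup>+\<omega>. emeasure (N \<omega>) ?S * indicator A \<omega> \<partial>M)"
        using leN by (intro nn_integral_mono mult_right_mono) auto
      then have finN: "(\<integral>\<^sup>+\<omega>. emeasure (N \<omega>) (?S \<inter> section_at H \<omega>) * indicator A \<omega> \<partial>M) \<noteq> \<infinity>"
        using S_eq fin by (auto simp: top_unique)
      have "(\<integral>\<^sup>+\<omega>. emeasure (N \<omega>) (?S \<inter> section_at (({0..T} \<times> space M) \<times> UNIV - H) \<omega>) * indicator A \<omega> \<partial>M)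
        = (\<integral>\<^sup>+\<omega>. emeasure (N \<omega>) ?S * indicator A \<omega> - emeasure (N \<omega>) (?S \<inter> section_at H \<omega>) * indicator A \<omega> \<partial>M)"
        by (intro nn_integral_cong) (auto simp: eN indicator_def)
      also have "\<dots> = (\<integral>\<^sup>+\<omega>. emeasure (N \<omega>) ?S * indicator A \<omega> \<partial>M) - (\<integral>\<^sup>+\<omega>. emeasure (N \<omega>) (?S \<inter> section_at H \<omega>) * indicator A \<omega> \<partial>M)"
        using finN leN by (intro nn_integral_diff) (auto intro!: AE_I2 mult_right_mono)
      also have "\<dots> = (\<integral>\<^sup>+\<omega>. emeasure lborel ?S * indicator A \<omega> \<partial>M) - (\<integral>\<^sup>+\<omega>. emeasure lborel (?S \<inter> section_at H \<omega>) * indicator A \<omega> \<partial>M)"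
        unfolding S_eq IHA by (simp add: nn_integral_cmult_indicator)
      also have "\<dots> = (\<integral>\<^sup>+\<omega>. emeasure lborel ?S * indicator A \<omega> - emeasure lborel (?S \<inter> section_at H \<omega>) * indicator A \<omega> \<partial>M)"
        using finN leL unfolding IHA by (intro nn_integral_diff[symmetric]) (auto intro!: AE_I2 mult_right_mono)
      also have "\<dots> = (\<integral>\<^sup>+\<omega>. emeasure lborel (?S \<inter> section_at (({0..T} \<times> space M) \<times> UNIV - H) \<omega>) * indicator A \<omega> \<partial>M)"
        by (intro nn_integral_cong) (auto simp: eL indicator_def)
      finally show "(\<integral>\<^sup>+\<omega>. emeasure (N \<omega>) (?S \<inter> section_at (({0..T} \<times> space M) \<times> UNIV - H) \<omega>) * indicator A \<omega> \<partial>M)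
        = (\<integral>\<^sup>+\<omega>. emeasure lborel (?S \<inter> section_at (({0..T} \<times> space M) \<times> UNIV - H) \<omega>) * indicator A \<omega> \<partial>M)" .
    qed
  next
    case (union H)
    note IH = union.IH
    have sec: "?S \<inter> section_at (\<Union>i. H i) \<omega> = (\<Union>i. ?S \<inter> section_at (H i) \<omega>)" for \<omega>
      by (auto simp: section_at_def)
    have disj: "disjoint_family (\<lambda>i. ?S \<inter> section_at (H i) \<omega>)" for \<omega>
      using union.hyps(1) by (fastforce simp: disjoint_family_on_def section_at_def)
    have bor: "?S \<inter> section_at (H i) \<omega> \<in> sets borel" if "\<omega> \<in> space M" for \<omega> i
      using IH that by blast
    have eN: "emeasure (N \<omega>) (?S \<inter> section_at (\<Union>i. H i) \<omega>) = (\<Sum>i. emeasure (N \<omega>) (?S \<inter> section_at (H i) \<omega>))"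
      if "\<omega> \<in> space M" for \<omega>
      unfolding sec using that disj boxS bor
      by (intro suminf_emeasure[symmetric]) (auto simp: sets_N boxed_def)
    have eL: "emeasure lborel (?S \<inter> section_at (\<Union>i. H i) \<omega>) = (\<Sum>i. emeasure lborel (?S \<inter> section_at (H i) \<omega>))"
      if "\<omega> \<in> space M" for \<omega>
      unfolding sec using that disj bor
      by (intro suminf_emeasure[symmetric]) auto
    have mN: "(\<lambda>\<omega>. emeasure (N \<omega>) (?S \<inter> section_at (H i) \<omega>)) \<in> borel_measurable (history M N b)"
      and mL [measurable]: "(\<lambda>\<omega>. emeasure lborel (?S \<inter> section_at (H i) \<omega>)) \<in> borel_measurable M" for i using IH by auto
    have mN' [measurable]: "(\<lambda>\<omega>. emeasure (N \<omega>) (?S \<inter> section_at (H i) \<omega>)) \<in> borel_measurable M" for i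
      using mN subM by auto
    show ?case
    proof (intro conjI ballI)
      fix \<omega> assume "\<omega> \<in> space M"
      then show "?S \<inter> section_at (\<Union>i. H i) \<omega> \<in> sets borel"
        unfolding sec using bor by (intro sets.countable_UN'') auto
    next
      show "(\<lambda>\<omega>. emeasure (N \<omega>) (?S \<inter> section_at (\<Union>i. H i) \<omega>)) \<in> borel_measurable (history M N b)"
        using mN by (subst measurable_cong[OF eN]) auto
      show "(\<lambda>\<omega>. emeasure lborel (?S \<inter> section_at (\<Union>i. H i) \<omega>)) \<in> borel_measurable M"
        using mL by (subst measurable_cong[OF eL]) auto
      fix A assume A: "A \<in> sets (history M N a)"
      then have AM [measurable]: "A \<in> sets M" using history_subset[of a] ab by auto
      have "(\<integral>\<^sup>+\<omega>. emeasure (N \<omega>) (?S \<inter> section_at (\<Union>i. H i) \<omega>) * indicator A \<omega> \<partial>M)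
        = (\<integral>\<^sup>+\<omega>. (\<Sum>i. emeasure (N \<omega>) (?S \<inter> section_at (H i) \<omega>) * indicator A \<omega>) \<partial>M)"
        by (intro nn_integral_cong) (simp add: eN)
      also have "\<dots> = (\<Sum>i. \<integral>\<^sup>+\<omega>. emeasure (N \<omega>) (?S \<inter> section_at (H i) \<omega>) * indicator A \<omega> \<partial>M)"
        by (rule nn_integral_suminf) simp
      also have "\<dots> = (\<Sum>i. \<integral>\<^sup>+\<omega>. emeasure lborel (?S \<inter> section_at (H i) \<omega>) * indicator A \<omega> \<partial>M)"
        using IH A by (intro suminf_cong) blast
      also have "\<dots> = (\<integral>\<^sup>+\<omega>. (\<Sum>i. emeasure lborel (?S \<inter> section_at (H i) \<omega>) * indicator A \<omega>) \<partial>M)"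
        by (rule nn_integral_suminf[symmetric]) simp
      also have "\<dots> = (\<integral>\<^sup>+\<omega>. emeasure lborel (?S \<inter> section_at (\<Union>i. H i) \<omega>) * indicator A \<omega> \<partial>M)"
        by (intro nn_integral_cong) (simp add: eL)
      finally show "(\<integral>\<^sup>+\<omega>. emeasure (N \<omega>) (?S \<inter> section_at (\<Union>i. H i) \<omega>) * indicator A \<omega> \<partial>M)
        = (\<integral>\<^sup>+\<omega>. emeasure lborel (?S \<inter> section_at (\<Union>i. H i) \<omega>) * indicator A \<omega> \<partial>M)" .
    qed
  qed
qed

section \<open>Controlled counting processes\<close>

text \<open>Admissible processes with an explicit upper bound, which fixes the height of the slab in which
  all relevant points lie.\<close>
definition control :: "real \<Rightarrow> (real \<Rightarrow> 'a \<Rightarrow> real) \<Rightarrow> bool" where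
  "control C \<Lambda> \<longleftrightarrow> (\<lambda>(t, \<omega>). \<Lambda> t \<omega>) \<in> borel_measurable (predictable_sigma T M N) \<and>
    (\<forall>t\<in>{0..T}. \<forall>\<omega>\<in>space M. 0 \<le> \<Lambda> t \<omega> \<and> \<Lambda> t \<omega> \<le> C)"

lemma controlD:
  assumes "control C \<Lambda>"
  shows "(\<lambda>(t, \<omega>). \<Lambda> t \<omega>) \<in> borel_measurable (predictable_sigma T M N)"
    "\<And>t \<omega>. 0 \<le> t \<Longrightarrow> t \<le> T \<Longrightarrow> \<omega> \<in> space M \<Longrightarrow> 0 \<le> \<Lambda> t \<omega>"
    "\<And>t \<omega>. 0 \<le> t \<Longrightarrow> t \<le> T \<Longrightarrow> \<omega> \<in> space M \<Longrightarrow> \<Lambda> t \<omega> \<le> C"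
  using assms by (auto simp: control_def)

lemma control_bound_nonneg: "control C \<Lambda> \<Longrightarrow> 0 \<le> C"
  using controlD[of C \<Lambda>] not_empty T_pos by (metis all_not_in_conv order_trans order_refl less_imp_le)

lemma admissible_iff: "\<Lambda> \<in> admissible T M N \<longleftrightarrow> (\<exists>C. control C \<Lambda>)"
  unfolding admissible_def control_def by blast

definition region :: "(real \<Rightarrow> 'a \<Rightarrow> real) \<Rightarrow> real \<Rightarrow> real \<Rightarrow> 'a \<Rightarrow> (real \<times> real) set" where
  "region \<Lambda> a b \<omega> = {(s, u) \<in> strip T. a \<le> s \<and> s < b \<and> u \<le> \<Lambda> s \<omega>}"

text \<open>The increment over \<open>[a, b)\<close> of the counting process; with \<open>a = 0\<close> it is the counting process itself.\<close>
definition jumps :: "(real \<Rightarrow> 'a \<Rightarrow> real) \<Rightarrow> real \<Rightarrow> real \<Rightarrow> 'a \<Rightarrow> nat" where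
  "jumps \<Lambda> a b \<omega> = count (region \<Lambda> a b \<omega>) \<omega>"

lemma counting_process_eq_jumps: "counting_process T N \<Lambda> t \<omega> = jumps \<Lambda> 0 t \<omega>"
proof -
  have "{(s, u) \<in> strip T. s < t \<and> u \<le> \<Lambda> s \<omega>} = region \<Lambda> 0 t \<omega>"
    by (auto simp: region_def strip_def)
  then show ?thesis by (simp add: counting_process_def jumps_def count_def)
qed

text \<open>The points under the graph of a control, as one set in the product of the predictable
  sigma-algebra with the line; cut off by a slab, its sections are the regions whose points are counted.\<close>
definition hypograph :: "(real \<Rightarrow> 'a \<Rightarrow> real) \<Rightarrow> ((real \<times> 'a) \<times> real) set" where
  "hypograph \<Lambda> = {x \<in> space (predictable_sigma T M N \<Otimes>\<^sub>M borel). snd x \<le> (case fst x of (t, \<omega>) \<Rightarrow> \<Lambda> t \<omega>)}"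

lemma hypograph_sets:
  assumes "control C \<Lambda>"
  shows "hypograph \<Lambda> \<in> sets (predictable_sigma T M N \<Otimes>\<^sub>M borel)"
proof -
  note [measurable] = controlD(1)[OF assms]
  show ?thesis unfolding hypograph_def by measurable
qed

lemma region_eq:
  assumes "control C \<Lambda>" "0 \<le> a" "b \<le> T" "\<omega> \<in> space M"
  shows "region \<Lambda> a b \<omega> = slab a b C \<inter> section_at (hypograph \<Lambda>) \<omega>"
  using assms controlD(3)[OF assms(1)]
  by (fastforce simp: region_def slab_def section_at_def hypograph_def space_pair_measure strip_def)

lemma region_empty: "b \<le> a \<Longrightarrow> region \<Lambda> a b \<omega> = {}"
  by (auto simp: region_def)

lemma region_boxed:
  assumes "control C \<Lambda>" "0 \<le> a" "b \<le> T" "\<omega> \<in> space M"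
  shows "boxed (region \<Lambda> a b \<omega>)"
proof (cases "a \<le> b")
  case True
  have "region \<Lambda> a b \<omega> \<in> sets borel"
    using campbell_predictable[OF assms(2) True assms(3) hypograph_sets[OF assms(1)]] assms
    by (simp add: region_eq)
  moreover have "region \<Lambda> a b \<omega> \<subseteq> slab a b C" using assms by (simp add: region_eq)
  ultimately show ?thesis
    using boxed_subset slab_boxed assms(2,3) by blast
next
  case False
  then show ?thesis by (simp add: region_empty boxed_def)
qed

lemma region_borel:
  assumes "control C \<Lambda>" "0 \<le> a" "b \<le> T" "\<omega> \<in> space M"
  shows "region \<Lambda> a b \<omega> \<in> sets borel"
  using region_boxed[OF assms] by (simp add: boxed_def)

lemma jumps_same: "b \<le> a \<Longrightarrow> jumps \<Lambda> a b \<omega> = 0"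
  by (simp add: jumps_def region_empty)

lemma jumps_le_slab:
  assumes "control C \<Lambda>" "0 \<le> a" "b \<le> T" "\<omega> \<in> space M"
  shows "jumps \<Lambda> a b \<omega> \<le> count (slab a b C) \<omega>"
  unfolding jumps_def using assms
  by (intro count_mono slab_boxed region_borel) (auto simp: region_eq)

lemma jumps_add:
  assumes "control C \<Lambda>" "0 \<le> a" "a \<le> b" "b \<le> c" "c \<le> T" "\<omega> \<in> space M"
  shows "jumps \<Lambda> a c \<omega> = jumps \<Lambda> a b \<omega> + jumps \<Lambda> b c \<omega>"
proof -
  have "region \<Lambda> a c \<omega> = region \<Lambda> a b \<omega> \<union> region \<Lambda> b c \<omega>"
    using assms by (auto simp: region_def)
  moreover have "region \<Lambda> a b \<omega> \<inter> region \<Lambda> b c \<omega> = {}"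
    by (auto simp: region_def)
  ultimately show ?thesis
    unfolding jumps_def using assms
    by (simp add: count_Un[OF _ region_boxed region_boxed])
qed

lemma jumps_history:
  assumes "control C \<Lambda>" "0 \<le> a" "a \<le> b" "b \<le> T"
  shows "jumps \<Lambda> a b \<in> history M N b \<rightarrow>\<^sub>M count_space UNIV"
proof -
  have "(\<lambda>\<omega>. emeasure (N \<omega>) (region \<Lambda> a b \<omega>)) \<in> borel_measurable (history M N b)"
    using campbell_predictable[OF assms(2-4) hypograph_sets[OF assms(1)], of C] assms
    by (subst measurable_cong[where g="\<lambda>\<omega>. emeasure (N \<omega>) (slab a b C \<inter> section_at (hypograph \<Lambda>) \<omega>)"])
      (auto simp: region_eq)
  then show ?thesis
    unfolding jumps_def count_def measure_def by measurable
qed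

lemma history_measurable_M:
  "t \<le> T \<Longrightarrow> f \<in> history M N t \<rightarrow>\<^sub>M K \<Longrightarrow> f \<in> M \<rightarrow>\<^sub>M K"
  using history_subset[of t] by (auto simp: measurable_def)

lemma jumps_measurable:
  assumes "control C \<Lambda>" "0 \<le> a" "b \<le> T"
  shows "jumps \<Lambda> a b \<in> M \<rightarrow>\<^sub>M count_space UNIV"
proof (cases "a \<le> b")
  case True
  then show ?thesis
  using history_measurable_M[OF assms(3) jumps_history[OF assms(1,2) _ assms(3)]] by auto
next
  case False
  then have "jumps \<Lambda> a b = (\<lambda>_. 0)" by (intro ext) (simp add: jumps_same)
  then show ?thesis by simp
qed

lemma jumps_mono:
  assumes "control C \<Lambda>" "0 \<le> b" "b \<le> c" "c \<le> T" "\<omega> \<in> space M"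
  shows "jumps \<Lambda> 0 b \<omega> \<le> jumps \<Lambda> 0 c \<omega>"
  using jumps_add[OF assms(1) order_refl assms(2-5)] by simp

text \<open>
  The path counts points with time strictly before \<open>t\<close>, and this region is the increasing union of those for earlier
  times. As the path is integer-valued, a positive level reached at \<open>t\<close> is already reached strictly before \<open>t\<close>, and
  by monotonicity at a rational time.
\<close>
lemma jumps_left_continuous:
  assumes \<Lambda>: "control C \<Lambda>" and t: "t \<le> T" and w: "\<omega> \<in> space M" and m: "1 \<le> m" "m \<le> jumps \<Lambda> 0 t \<omega>"
  shows "\<exists>q\<in>\<rat>. 0 \<le> q \<and> q < t \<and> m \<le> jumps \<Lambda> 0 q \<omega>"
proof -
  define r where "r i = t - inverse (real (Suc i))" for i :: nat
  have rT: "r i \<le> T" for i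
  proof -
    have "0 < inverse (real (Suc i))" by simp
    then show ?thesis using t unfolding r_def by linarith
  qed
  have "(\<lambda>i. emeasure (N \<omega>) (region \<Lambda> 0 (r i) \<omega>)) \<longlonglongrightarrow> emeasure (N \<omega>) (\<Union>i. region \<Lambda> 0 (r i) \<omega>)"
  proof (rule Lim_emeasure_incseq)
    show "range (\<lambda>i. region \<Lambda> 0 (r i) \<omega>) \<subseteq> sets (N \<omega>)"
      using region_boxed[OF \<Lambda> order_refl rT w] w by (auto simp: sets_N boxed_def)
    show "incseq (\<lambda>i. region \<Lambda> 0 (r i) \<omega>)"
    proof (rule incseq_SucI)
      fix i
      have "r i \<le> r (Suc i)" by (simp add: r_def field_simps)
      then show "region \<Lambda> 0 (r i) \<omega> \<subseteq> region \<Lambda> 0 (r (Suc i)) \<omega>"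
        by (auto simp: region_def)
    qed
  qed
  also have "(\<Union>i. region \<Lambda> 0 (r i) \<omega>) = region \<Lambda> 0 t \<omega>"
  proof safe
    fix x y i assume "(x, y) \<in> region \<Lambda> 0 (r i) \<omega>"
    moreover have "r i < t" by (simp add: r_def)
    ultimately show "(x, y) \<in> region \<Lambda> 0 t \<omega>" unfolding region_def by auto
  next
    fix x y assume xy: "(x, y) \<in> region \<Lambda> 0 t \<omega>"
    then have "0 < t - x" by (auto simp: region_def)
    then obtain i where "inverse (real (Suc i)) < t - x" using reals_Archimedean by blast
    then have "x < r i" unfolding r_def by linarith
    with xy show "(x, y) \<in> (\<Union>i. region \<Lambda> 0 (r i) \<omega>)" by (auto simp: region_def intro!: exI[of _ i])
  qed
  finally have "(\<lambda>i. of_nat (jumps \<Lambda> 0 (r i) \<omega>) :: ennreal) \<longlonglongrightarrow> of_nat (jumps \<Lambda> 0 t \<omega>)"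
    using emeasure_N[OF w region_boxed[OF \<Lambda> order_refl rT w]] emeasure_N[OF w region_boxed[OF \<Lambda> order_refl t w]]
    by (simp add: jumps_def)
  moreover have "of_nat (m - 1) < (of_nat (jumps \<Lambda> 0 t \<omega>) :: ennreal)"
    using m by (subst of_nat_less_iff) auto
  ultimately have "\<forall>\<^sub>F i in sequentially. of_nat (m - 1) < (of_nat (jumps \<Lambda> 0 (r i) \<omega>) :: ennreal)"
    by (rule order_tendstoD)
  then obtain i where "of_nat (m - 1) < (of_nat (jumps \<Lambda> 0 (r i) \<omega>) :: ennreal)"
    unfolding eventually_sequentially by blast
  then have i: "m \<le> jumps \<Lambda> 0 (r i) \<omega>" using m by (subst (asm) of_nat_less_iff) auto
  have pos: "0 < r i"
  proof (rule ccontr)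
    assume "\<not> 0 < r i"
    then have "jumps \<Lambda> 0 (r i) \<omega> = 0" by (intro jumps_same) auto
    with i m show False by simp
  qed
  have "r i < t" by (simp add: r_def)
  then obtain q where q: "q \<in> \<rat>" "r i < q" "q < t" using Rats_dense_in_real by blast
  have "jumps \<Lambda> 0 (r i) \<omega> \<le> jumps \<Lambda> 0 q \<omega>"
    using jumps_add[OF \<Lambda> _ _ _ _ w, of 0 "r i" q] q t pos by auto
  with i q pos show ?thesis by (intro bexI[of _ q]) auto
qed

text \<open>
  By left-continuity and monotonicity, the event that the process has reached level \<open>m\<close> is the
  countable union over rational \<open>q\<close> of the predictable rectangles \<open>(q, T] \<times> {X q \<ge> m}\<close>.
\<close>
lemma jumps_predictable:
  assumes \<Lambda>: "control C \<Lambda>"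
  shows "(\<lambda>(t, \<omega>). jumps \<Lambda> 0 t \<omega>) \<in> predictable_sigma T M N \<rightarrow>\<^sub>M count_space UNIV"
proof -
  let ?P = "predictable_sigma T M N" and ?X = "\<lambda>(t, \<omega>). jumps \<Lambda> 0 t \<omega>"
  have ge: "{x\<in>space ?P. m \<le> ?X x} \<in> sets ?P" for m
  proof (cases "m = 0")
    case True
    then have "{x\<in>space ?P. m \<le> ?X x} = space ?P" by simp
    moreover have "space ?P \<in> sets ?P" by (rule sets.top)
    ultimately show ?thesis by (rule ssubst)
  next
    case False
    let ?U = "\<lambda>q. {q<..T} \<times> {\<omega>\<in>space M. m \<le> jumps \<Lambda> 0 q \<omega>}"
    have "{x\<in>space ?P. m \<le> ?X x} \<subseteq> (\<Union>q\<in>\<rat> \<inter> {0..T}. ?U q)"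
    proof
      fix x assume "x \<in> {x\<in>space ?P. m \<le> ?X x}"
      then obtain t \<omega> where x: "x = (t, \<omega>)" "0 \<le> t" "t \<le> T" "\<omega> \<in> space M" "m \<le> jumps \<Lambda> 0 t \<omega>"
        unfolding space_predictable by (cases x) auto
      then obtain q where q: "q\<in>\<rat>" "0 \<le> q" "q < t" "m \<le> jumps \<Lambda> 0 q \<omega>"
        using jumps_left_continuous[OF \<Lambda>, of t \<omega> m] False by (metis One_nat_def Suc_leI neq0_conv)
      show "x \<in> (\<Union>q\<in>\<rat> \<inter> {0..T}. ?U q)"
        by (rule UN_I[of q]) (use x q in simp_all)
    qed
    moreover have "?U q \<subseteq> {x\<in>space ?P. m \<le> ?X x}" if q: "q \<in> {0..T}" for q
    proof clarify
      fix t \<omega> assume *: "t \<in> {q<..T}" "\<omega> \<in> space M" "m \<le> jumps \<Lambda> 0 q \<omega>"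
      then show "(t, \<omega>) \<in> space ?P \<and> m \<le> jumps \<Lambda> 0 t \<omega>"
        using q jumps_mono[OF \<Lambda>, of q t \<omega>] by simp
    qed
    ultimately have "{x\<in>space ?P. m \<le> ?X x} = (\<Union>q\<in>\<rat> \<inter> {0..T}. ?U q)"
      by blast
    moreover
    have "?U q \<in> sets ?P" if "q \<in> {0..T}" for q
    proof -
      have "{\<omega>\<in>space (history M N q). jumps \<Lambda> 0 q \<omega> \<in> {m..}} \<in> sets (history M N q)"
        by (rule measurable_sets_Collect[OF jumps_history[OF \<Lambda> order_refl, of q]]) (use that in simp_all)
      then show ?thesis
        using that by (intro rect_predictable) simp_all
    qed
    then have "(\<Union>q\<in>\<rat> \<inter> {0..T}. ?U q) \<in> sets ?P"
      by (intro sets.countable_UN' countable_Int1 countable_rat) blast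
    ultimately show ?thesis by (simp only:)
  qed
  have "?X -` {m} \<inter> space ?P = {x\<in>space ?P. m \<le> ?X x} - {x\<in>space ?P. Suc m \<le> ?X x}" for m
    by auto
  then have "?X -` {m} \<inter> space ?P \<in> sets ?P" for m
    using ge[of m] ge[of "Suc m"] by (simp only: sets.Diff)
  then show ?thesis
    by (subst measurable_count_space_eq2_countable) simp_all
qed

lemma fst_predictable: "fst \<in> borel_measurable (predictable_sigma T M N)"
  unfolding borel_measurable_iff_greater
proof
  fix c :: real
  let ?P = "predictable_sigma T M N"
  consider "c < 0" | "0 \<le> c" "c \<le> T" | "T < c" by linarith
  then show "{w \<in> space ?P. c < fst w} \<in> sets ?P"
  proof cases
    case 1
    then have "{w \<in> space ?P. c < fst w} = space ?P" by auto
    then show ?thesis by (simp only: sets.top)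
  next
    case 2
    then have "{w \<in> space ?P. c < fst w} = {c<..T} \<times> space M" by auto
    then show ?thesis using 2 rect_predictable[of c T "space M"] sets.top[of "history M N c"] by simp
  next
    case 3
    then have "{w \<in> space ?P. c < fst w} = {}" by auto
    then show ?thesis by (simp only: sets.empty_sets)
  qed
qed

text \<open>This makes the integrands of the Dynkin formula and the Picard iterates predictable.\<close>
lemma state_function_predictable:
  assumes \<Lambda>: "control C \<Lambda>" and \<psi>: "\<And>n. continuous_on {0..T} (\<lambda>t. \<psi> t n)"
  shows "(\<lambda>(t, \<omega>). \<psi> t (jumps \<Lambda> 0 t \<omega>) :: real) \<in> borel_measurable (predictable_sigma T M N)"
proof -
  have f: "fst \<in> predictable_sigma T M N \<rightarrow>\<^sub>M restrict_space borel {0..T}"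
    using fst_predictable by (intro measurable_restrict_space2) auto
  have "(\<lambda>x. \<psi> (fst x) n) \<in> borel_measurable (predictable_sigma T M N)" for n
    by (rule measurable_compose[OF f borel_measurable_continuous_on_restrict[OF \<psi>]])
  from measurable_compose_countable[OF this jumps_predictable[OF \<Lambda>]]
  show ?thesis by (simp add: case_prod_beta)
qed

section \<open>Time integrals and the compensator of the counting process\<close>

text \<open>
  Predictability refers to a sigma-algebra on \<open>[0, T] \<times> \<Omega>\<close> only. Multiplying by the indicator of
  \<open>[0, T]\<close> turns a predictable process into a jointly measurable function on the whole product, to which Fubini's theorem applies.
\<close>
lemma predictable_joint:
  fixes g :: "real \<times> 'a \<Rightarrow> real"
  assumes "g \<in> borel_measurable (predictable_sigma T M N)"
  shows "(\<lambda>x. g x * indicator {0..T} (fst x)) \<in> borel_measurable (lborel \<Otimes>\<^sub>M M)"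
proof -
  let ?\<Omega> = "{0..T} \<times> space M"
  have O: "?\<Omega> \<in> sets (lborel \<Otimes>\<^sub>M M)" by auto
  have "(\<lambda>x. x) \<in> restrict_space (lborel \<Otimes>\<^sub>M M) ?\<Omega> \<rightarrow>\<^sub>M predictable_sigma T M N"
  proof (rule measurable_sigma_sets[OF sets_predictable])
    show "{{s<..t} \<times> A |s t A. 0 \<le> s \<and> s \<le> t \<and> t \<le> T \<and> A \<in> sets (history M N s)} \<subseteq> Pow ?\<Omega>"
      using history_into_space by force
    show "(\<lambda>x. x) \<in> space (restrict_space (lborel \<Otimes>\<^sub>M M) ?\<Omega>) \<rightarrow> ?\<Omega>"
      by (auto simp: space_restrict_space)
    fix y assume "y \<in> {{s<..t} \<times> A |s t A. 0 \<le> s \<and> s \<le> t \<and> t \<le> T \<and> A \<in> sets (history M N s)}"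
    then obtain s t A where y: "y = {s<..t} \<times> A" "0 \<le> s" "s \<le> t" "t \<le> T" "A \<in> sets (history M N s)" by blast
    then have "A \<in> sets M" using history_subset[of s] by auto
    then have "y \<in> sets (lborel \<Otimes>\<^sub>M M)" "y \<subseteq> ?\<Omega>"
      using y sets.sets_into_space[of A M] by auto
    then show "(\<lambda>x. x) -` y \<inter> space (restrict_space (lborel \<Otimes>\<^sub>M M) ?\<Omega>) \<in> sets (restrict_space (lborel \<Otimes>\<^sub>M M) ?\<Omega>)"
      using O by (auto simp: sets_restrict_space_iff space_restrict_space space_pair_measure intro!: sets.Int)
  qed
  then have "g \<in> borel_measurable (restrict_space (lborel \<Otimes>\<^sub>M M) ?\<Omega>)"
    using assms by (rule measurable_compose)
  then have "(\<lambda>x. g x * indicator ?\<Omega> x) \<in> borel_measurable (lborel \<Otimes>\<^sub>M M)"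
    using O by (subst (asm) borel_measurable_restrict_space_iff) (auto simp: space_pair_measure mult.commute)
  then show ?thesis
    by (rule measurable_cong[THEN iffD1, rotated]) (auto simp: indicator_def space_pair_measure)
qed

definition time_integral :: "(real \<times> 'a \<Rightarrow> real) \<Rightarrow> real \<Rightarrow> real \<Rightarrow> 'a \<Rightarrow> real" where
  "time_integral g a b \<omega> = (\<integral>s. g (s, \<omega>) * indicator {a..<b} s \<partial>lborel)"

definition bounded_predictable :: "real \<Rightarrow> (real \<times> 'a \<Rightarrow> real) \<Rightarrow> bool" where
  "bounded_predictable K g \<longleftrightarrow> g \<in> borel_measurable (predictable_sigma T M N) \<and>
    (\<forall>t\<in>{0..T}. \<forall>\<omega>\<in>space M. \<bar>g (t, \<omega>)\<bar> \<le> K)"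

lemma control_bounded_predictable:
  "control C \<Lambda> \<Longrightarrow> bounded_predictable C (\<lambda>(t, \<omega>). \<Lambda> t \<omega>)"
  by (auto simp: control_def bounded_predictable_def)

lemma joint_window:
  assumes "bounded_predictable K g" "0 \<le> a" "b \<le> T"
  shows "(\<lambda>x. g x * indicator {a..<b} (fst x)) \<in> borel_measurable (lborel \<Otimes>\<^sub>M M)"
proof -
  have [measurable]: "(\<lambda>x. g x * indicator {0..T} (fst x)) \<in> borel_measurable (lborel \<Otimes>\<^sub>M M)"
    using assms by (intro predictable_joint) (simp add: bounded_predictable_def)
  have "(\<lambda>x. (g x * indicator {0..T} (fst x)) * indicator {a..<b} (fst x)) \<in> borel_measurable (lborel \<Otimes>\<^sub>M M)"
    by measurable
  then show ?thesis
    by (rule measurable_cong[THEN iffD1, rotated]) (use assms in \<open>auto simp: indicator_def\<close>)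
qed

lemma window_measurable:
  assumes "bounded_predictable K g" "0 \<le> a" "b \<le> T" "\<omega> \<in> space M"
  shows "(\<lambda>s. g (s, \<omega>) * indicator {a..<b} s) \<in> borel_measurable lborel"
  using measurable_compose[OF measurable_Pair2'[OF assms(4)] joint_window[OF assms(1-3)]] by simp

lemma window_integrable:
  assumes "bounded_predictable K g" "0 \<le> a" "b \<le> T" "\<omega> \<in> space M"
  shows "integrable lborel (\<lambda>s. g (s, \<omega>) * indicator {a..<b} s)"
proof (rule Bochner_Integration.integrable_bound[of _ "\<lambda>s. K * indicator {a..<b} s"])
  show "integrable lborel (\<lambda>s. K * indicator {a..<b} s :: real)"
    by (cases "a \<le> b") auto
  show "(\<lambda>s. g (s, \<omega>) * indicator {a..<b} s) \<in> borel_measurable lborel"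
    by (rule window_measurable[OF assms])
  show "AE s in lborel. norm (g (s, \<omega>) * indicator {a..<b} s) \<le> norm (K * indicator {a..<b} s)"
  proof (rule AE_I2)
    fix s
    show "norm (g (s, \<omega>) * indicator {a..<b} s) \<le> norm (K * indicator {a..<b} s)"
    proof (cases "s \<in> {a..<b}")
      case True
      then have "\<bar>g (s, \<omega>)\<bar> \<le> K" using assms by (auto simp: bounded_predictable_def)
      then show ?thesis using True by simp
    qed simp
  qed
qed

lemma integral_window_const: "a \<le> b \<Longrightarrow> (\<integral>s. K * indicator {a..<b} s \<partial>lborel) = K * (b - a :: real)"
  by simp

lemma time_integral_abs_le:
  assumes "bounded_predictable K g" "0 \<le> a" "a \<le> b" "b \<le> T" "\<omega> \<in> space M"
    and B: "\<And>s. a \<le> s \<Longrightarrow> s < b \<Longrightarrow> \<bar>g (s, \<omega>)\<bar> \<le> B"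
  shows "\<bar>time_integral g a b \<omega>\<bar> \<le> B * (b - a)"
proof -
  have "integrable lborel (\<lambda>s. B * indicator {a..<b} s)" using assms(3) by simp
  then have "\<bar>time_integral g a b \<omega>\<bar> \<le> (\<integral>s. B * indicator {a..<b} s \<partial>lborel)"
    unfolding time_integral_def
    using window_integrable[OF assms(1,2,4,5)] assms(3) B
    by (intro integral_abs_bound[THEN order_trans] integral_mono integrable_abs) (simp_all add: indicator_def)
  then show ?thesis unfolding integral_window_const[OF assms(3)] .
qed

lemma time_integral_measurable:
  assumes "bounded_predictable K g" "0 \<le> a" "b \<le> T"
  shows "time_integral g a b \<in> borel_measurable M"
proof -
  have "(\<lambda>(\<omega>, s). g (s, \<omega>) * indicator {a..<b} s) \<in> borel_measurable (M \<Otimes>\<^sub>M lborel)"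
    using measurable_compose[OF measurable_pair_swap' joint_window[OF assms]]
    by (simp add: case_prod_beta)
  then have "(\<lambda>\<omega>. \<integral>s. g (s, \<omega>) * indicator {a..<b} s \<partial>lborel) \<in> borel_measurable M"
    by (intro lborel.borel_measurable_lebesgue_integral) simp
  then show ?thesis by (simp add: time_integral_def[abs_def])
qed

lemma time_integral_integrable:
  assumes "bounded_predictable K g" "0 \<le> a" "a \<le> b" "b \<le> T"
  shows "integrable M (time_integral g a b)"
proof (rule integrable_const_bound)
  show "AE \<omega> in M. norm (time_integral g a b \<omega>) \<le> K * (b - a)"
    using assms by (intro AE_I2) (auto intro!: time_integral_abs_le[OF assms] simp: bounded_predictable_def)
  show "time_integral g a b \<in> borel_measurable M"
    using assms by (intro time_integral_measurable)
qed

lemma time_integral_add: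
  assumes "bounded_predictable K g" "0 \<le> a" "a \<le> b" "b \<le> c" "c \<le> T" "\<omega> \<in> space M"
  shows "time_integral g a c \<omega> = time_integral g a b \<omega> + time_integral g b c \<omega>"
proof -
  have "time_integral g a b \<omega> + time_integral g b c \<omega>
    = (\<integral>s. g (s, \<omega>) * indicator {a..<b} s + g (s, \<omega>) * indicator {b..<c} s \<partial>lborel)"
    unfolding time_integral_def using assms
    by (intro Bochner_Integration.integral_add[symmetric] window_integrable[OF assms(1)]) auto
  also have "\<dots> = time_integral g a c \<omega>"
    unfolding time_integral_def using assms(3,4)
    by (intro Bochner_Integration.integral_cong) (auto simp: indicator_def)
  finally show ?thesis by simp
qed

text \<open>The area under a graph is the integral of the function, by integrating the lengths of the vertical sections.\<close>
lemma emeasure_region: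
  assumes \<Lambda>: "control C \<Lambda>" and ab: "0 \<le> a" "b \<le> T" and w: "\<omega> \<in> space M"
  shows "emeasure lborel (region \<Lambda> a b \<omega>) = ennreal (time_integral (\<lambda>(t, \<omega>). \<Lambda> t \<omega>) a b \<omega>)"
proof -
  have "region \<Lambda> a b \<omega> \<in> sets (lborel \<Otimes>\<^sub>M lborel)"
    unfolding lborel_prod using region_borel[OF \<Lambda> ab w] by simp
  then have "emeasure (lborel \<Otimes>\<^sub>M lborel) (region \<Lambda> a b \<omega>)
     = (\<integral>\<^sup>+s. emeasure lborel (Pair s -` region \<Lambda> a b \<omega>) \<partial>lborel)"
    by (rule lborel.emeasure_pair_measure_alt)
  also have "\<dots> = (\<integral>\<^sup>+s. ennreal (\<Lambda> s \<omega> * indicator {a..<b} s) \<partial>lborel)"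
  proof (rule nn_integral_cong)
    fix s
    have "Pair s -` region \<Lambda> a b \<omega> = (if s \<in> {a..<b} then {0..\<Lambda> s \<omega>} else {})"
      using ab by (auto simp: region_def strip_def)
    then show "emeasure lborel (Pair s -` region \<Lambda> a b \<omega>) = ennreal (\<Lambda> s \<omega> * indicator {a..<b} s)"
      using controlD(2)[OF \<Lambda>, of s \<omega>] ab w by simp
  qed
  also have "\<dots> = ennreal (time_integral (\<lambda>(t, \<omega>). \<Lambda> t \<omega>) a b \<omega>)"
    unfolding time_integral_def
    using window_integrable[OF control_bounded_predictable[OF \<Lambda>] ab w] controlD(2)[OF \<Lambda>] ab w
    by (subst nn_integral_eq_integral) (auto simp: indicator_def)
  finally show ?thesis by (simp add: lborel_prod)
qed

lemma nn_integral_jumps: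
  assumes \<Lambda>: "control C \<Lambda>" and ab: "0 \<le> a" "a \<le> b" "b \<le> T" and A: "A \<in> sets (history M N a)"
  shows "(\<integral>\<^sup>+\<omega>. of_nat (jumps \<Lambda> a b \<omega>) * indicator A \<omega> \<partial>M)
    = (\<integral>\<^sup>+\<omega>. ennreal (time_integral (\<lambda>(t, \<omega>). \<Lambda> t \<omega>) a b \<omega>) * indicator A \<omega> \<partial>M)"
proof -
  have "(\<integral>\<^sup>+\<omega>. of_nat (jumps \<Lambda> a b \<omega>) * indicator A \<omega> \<partial>M)
     = (\<integral>\<^sup>+\<omega>. emeasure (N \<omega>) (slab a b C \<inter> section_at (hypograph \<Lambda>) \<omega>) * indicator A \<omega> \<partial>M)"
  proof (rule nn_integral_cong)
    fix \<omega> assume w: "\<omega> \<in> space M"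
    have "of_nat (jumps \<Lambda> a b \<omega>) = emeasure (N \<omega>) (region \<Lambda> a b \<omega>)"
      using emeasure_N[OF w region_boxed[OF \<Lambda> ab(1,3) w]] by (simp add: jumps_def)
    then show "of_nat (jumps \<Lambda> a b \<omega>) * indicator A \<omega>
        = emeasure (N \<omega>) (slab a b C \<inter> section_at (hypograph \<Lambda>) \<omega>) * indicator A \<omega>"
      using region_eq[OF \<Lambda> ab(1,3) w] by simp
  qed
  also have "\<dots> = (\<integral>\<^sup>+\<omega>. emeasure lborel (slab a b C \<inter> section_at (hypograph \<Lambda>) \<omega>) * indicator A \<omega> \<partial>M)"
    using campbell_predictable[OF ab hypograph_sets[OF \<Lambda>]] A by blast
  also have "\<dots> = (\<integral>\<^sup>+\<omega>. ennreal (time_integral (\<lambda>(t, \<omega>). \<Lambda> t \<omega>) a b \<omega>) * indicator A \<omega> \<partial>M)"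
    using ab by (intro nn_integral_cong) (simp add: region_eq[OF \<Lambda>, symmetric] emeasure_region[OF \<Lambda>])
  finally show ?thesis .
qed

lemma time_integral_nonneg:
  assumes "control C \<Lambda>" "0 \<le> a" "b \<le> T" "\<omega> \<in> space M"
  shows "0 \<le> time_integral (\<lambda>(t, \<omega>). \<Lambda> t \<omega>) a b \<omega>"
  unfolding time_integral_def using assms controlD(2)[OF assms(1)]
  by (intro Bochner_Integration.integral_nonneg) (auto simp: indicator_def)

lemma jumps_integrable:
  assumes \<Lambda>: "control C \<Lambda>" and ab: "0 \<le> a" "a \<le> b" "b \<le> T"
  shows "integrable M (\<lambda>\<omega>. real (jumps \<Lambda> a b \<omega>))"
proof (rule integrableI_bounded)
  note [measurable] = jumps_measurable[OF \<Lambda> ab(1,3)]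
  show "(\<lambda>\<omega>. real (jumps \<Lambda> a b \<omega>)) \<in> borel_measurable M" by measurable
  have "(\<integral>\<^sup>+ \<omega>. ennreal (norm (real (jumps \<Lambda> a b \<omega>))) \<partial>M) \<le> (\<integral>\<^sup>+\<omega>. of_nat (count (slab a b C) \<omega>) \<partial>M)"
    using jumps_le_slab[OF \<Lambda> ab(1,3)]
    by (intro nn_integral_mono) (simp add: ennreal_of_nat_eq_real_of_nat)
  also have "\<dots> < \<infinity>"
    using nn_integral_count[OF slab_boxed[of a b C]] emeasure_boxed[OF slab_boxed[of a b C]] ab by simp
  finally show "(\<integral>\<^sup>+ \<omega>. ennreal (norm (real (jumps \<Lambda> a b \<omega>))) \<partial>M) < \<infinity>" .
qed

text \<open>
  The compensated increment has conditional mean 0 given the history at time \<open>a\<close>, by Campbell's formula on every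
  event of that history; hence it is orthogonal to every bounded variable that is known at \<open>a\<close>.
\<close>
lemma compensated_jumps_orthogonal:
  assumes \<Lambda>: "control C \<Lambda>" and ab: "0 \<le> a" "a \<le> b" "b \<le> T"
    and Y: "Y \<in> borel_measurable (history M N a)" "\<And>\<omega>. \<omega> \<in> space M \<Longrightarrow> \<bar>Y \<omega>\<bar> \<le> K"
  shows "integrable M (\<lambda>\<omega>. Y \<omega> * (real (jumps \<Lambda> a b \<omega>) - time_integral (\<lambda>(t, \<omega>). \<Lambda> t \<omega>) a b \<omega>))" (is "integrable M (\<lambda>\<omega>. Y \<omega> * ?W \<omega>)")
    and "(\<integral>\<omega>. Y \<omega> * (real (jumps \<Lambda> a b \<omega>) - time_integral (\<lambda>(t, \<omega>). \<Lambda> t \<omega>) a b \<omega>) \<partial>M) = 0"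
proof -
  let ?I = "time_integral (\<lambda>(t, \<omega>). \<Lambda> t \<omega>) a b"
  have aT: "a \<le> T" using ab by simp
  interpret F: finite_measure_subalgebra M "history M N a"
    by unfold_locales (simp add: subalgebra_def history_subset[OF aT])
  have Jint: "integrable M (\<lambda>\<omega>. real (jumps \<Lambda> a b \<omega>))" by (rule jumps_integrable[OF \<Lambda> ab])
  have Iint: "integrable M ?I" by (rule time_integral_integrable[OF control_bounded_predictable[OF \<Lambda>] ab])
  have Wint: "integrable M ?W" using Jint Iint by (rule Bochner_Integration.integrable_diff)
  have YM [measurable]: "Y \<in> borel_measurable M" using Y(1) aT by (intro history_measurable_M) auto
  show YW: "integrable M (\<lambda>\<omega>. Y \<omega> * ?W \<omega>)"
  proof (rule Bochner_Integration.integrable_bound[of _ "\<lambda>\<omega>. K * ?W \<omega>"])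
    show "integrable M (\<lambda>\<omega>. K * ?W \<omega>)" using Wint by simp
    show "(\<lambda>\<omega>. Y \<omega> * ?W \<omega>) \<in> borel_measurable M" using Wint by simp
    show "AE \<omega> in M. norm (Y \<omega> * ?W \<omega>) \<le> norm (K * ?W \<omega>)"
      using Y(2) by (intro AE_I2) (force simp: abs_mult intro!: mult_right_mono)
  qed
  have "AE \<omega> in M. real_cond_exp M (history M N a) ?W \<omega> = 0"
  proof (rule F.real_cond_exp_charact)
    fix A assume A: "A \<in> sets (history M N a)"
    then have [measurable]: "A \<in> sets M" using history_subset[OF aT] by blast
    have iJ: "integrable M (\<lambda>\<omega>. real (jumps \<Lambda> a b \<omega>) * indicator A \<omega>)"
      using Jint by (intro integrable_real_mult_indicator) auto
    have iI: "integrable M (\<lambda>\<omega>. ?I \<omega> * indicator A \<omega>)"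
      using Iint by (intro integrable_real_mult_indicator) auto
    have "ennreal (\<integral>\<omega>. real (jumps \<Lambda> a b \<omega>) * indicator A \<omega> \<partial>M) = (\<integral>\<^sup>+\<omega>. of_nat (jumps \<Lambda> a b \<omega>) * indicator A \<omega> \<partial>M)"
      using iJ by (subst nn_integral_eq_integral[symmetric])
        (auto intro!: nn_integral_cong simp: indicator_def ennreal_of_nat_eq_real_of_nat)
    also have "\<dots> = (\<integral>\<^sup>+\<omega>. ennreal (?I \<omega>) * indicator A \<omega> \<partial>M)"
      by (rule nn_integral_jumps[OF \<Lambda> ab A])
    also have "\<dots> = ennreal (\<integral>\<omega>. ?I \<omega> * indicator A \<omega> \<partial>M)"
      using iI time_integral_nonneg[OF \<Lambda> ab(1,3)] by (subst nn_integral_eq_integral[symmetric])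
        (auto intro!: nn_integral_cong AE_I2 simp: indicator_def)
    finally have "(\<integral>\<omega>. real (jumps \<Lambda> a b \<omega>) * indicator A \<omega> \<partial>M) = (\<integral>\<omega>. ?I \<omega> * indicator A \<omega> \<partial>M)"
      using time_integral_nonneg[OF \<Lambda> ab(1,3)]
      by (subst (asm) ennreal_inj) (auto intro!: Bochner_Integration.integral_nonneg_AE)
    then have "(\<integral>\<omega>. ?W \<omega> * indicator A \<omega> \<partial>M) = 0"
      using iJ iI by (simp add: left_diff_distrib)
    then show "(\<integral>\<omega>\<in>A. ?W \<omega> \<partial>M) = (\<integral>\<omega>\<in>A. 0 \<partial>M)"
      by (simp add: set_lebesgue_integral_def mult.commute)
  qed (use Wint in auto)
  then have "(\<integral>\<omega>. Y \<omega> * real_cond_exp M (history M N a) ?W \<omega> \<partial>M) = (\<integral>\<omega>. 0 \<partial>M)"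
    by (intro integral_cong_AE) auto
  then show "(\<integral>\<omega>. Y \<omega> * ?W \<omega> \<partial>M) = 0"
    using F.real_cond_exp_intg(2)[OF YW Y(1)] Wint by simp
qed

section \<open>The Dynkin formula\<close>

lemma expectation_count:
  assumes "boxed F"
  shows "integrable M (\<lambda>\<omega>. real (count F \<omega>))" "(\<integral>\<omega>. real (count F \<omega>) \<partial>M) = measure lborel F"
proof -
  note [measurable] = count_measurable[OF assms]
  have "(\<integral>\<^sup>+\<omega>. ennreal (real (count F \<omega>)) \<partial>M) = ennreal (measure lborel F)"
    using nn_integral_count[OF assms] emeasure_boxed[OF assms]
    by (simp add: ennreal_of_nat_eq_real_of_nat)
  then have "integrable M (\<lambda>\<omega>. real (count F \<omega>)) \<and> (\<integral>\<omega>. real (count F \<omega>) \<partial>M) = measure lborel F"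
    by (subst (asm) nn_integral_eq_integrable) auto
  then show "integrable M (\<lambda>\<omega>. real (count F \<omega>))" "(\<integral>\<omega>. real (count F \<omega>) \<partial>M) = measure lborel F"
    by auto
qed

lemma expectation_count_pair:
  assumes "boxed F"
  shows "integrable M (\<lambda>\<omega>. real (count F \<omega> * (count F \<omega> - 1)))"
    "(\<integral>\<omega>. real (count F \<omega> * (count F \<omega> - 1)) \<partial>M) = (measure lborel F)\<^sup>2"
proof -
  note [measurable] = count_measurable[OF assms]
  have "(\<integral>\<^sup>+\<omega>. ennreal (real (count F \<omega> * (count F \<omega> - 1))) \<partial>M) = ennreal ((measure lborel F)\<^sup>2)"
    using nn_integral_count_pair[OF assms]
    by (simp only: ennreal_of_nat_eq_real_of_nat)
  then have "integrable M (\<lambda>\<omega>. real (count F \<omega> * (count F \<omega> - 1))) \<and>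
     (\<integral>\<omega>. real (count F \<omega> * (count F \<omega> - 1)) \<partial>M) = (measure lborel F)\<^sup>2"
    by (subst (asm) nn_integral_eq_integrable) auto
  then show "integrable M (\<lambda>\<omega>. real (count F \<omega> * (count F \<omega> - 1)))"
    "(\<integral>\<omega>. real (count F \<omega> * (count F \<omega> - 1)) \<partial>M) = (measure lborel F)\<^sup>2"
    by auto
qed

lemma measure_slab:
  assumes "0 \<le> C" "a \<le> b" shows "measure lborel (slab a b C) = C * (b - a)"
proof -
  have "emeasure (lborel \<Otimes>\<^sub>M lborel) ({a..<b} \<times> {0..C}) = ennreal (C * (b - a))"
    using assms by (subst lborel.emeasure_pair_measure_Times) (auto simp: ennreal_mult[symmetric] mult.commute)
  then show ?thesis
    using assms by (simp add: lborel_prod slab_def measure_def)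
qed

lemma bounded_predictable_lincomb:
  assumes "bounded_predictable K f" "bounded_predictable L g"
  shows "bounded_predictable (K + \<bar>c\<bar> * L) (\<lambda>x. f x + c * g x)"
  unfolding bounded_predictable_def
proof (intro conjI ballI)
  show "(\<lambda>x. f x + c * g x) \<in> borel_measurable (predictable_sigma T M N)"
    using assms by (auto simp: bounded_predictable_def)
  fix t \<omega> assume "t \<in> {0..T}" "\<omega> \<in> space M"
  then have "\<bar>f (t, \<omega>)\<bar> \<le> K" "\<bar>g (t, \<omega>)\<bar> \<le> L" using assms by (auto simp: bounded_predictable_def)
  then have "\<bar>f (t, \<omega>)\<bar> + \<bar>c\<bar> * \<bar>g (t, \<omega>)\<bar> \<le> K + \<bar>c\<bar> * L"
    by (intro add_mono mult_left_mono) auto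
  then show "\<bar>f (t, \<omega>) + c * g (t, \<omega>)\<bar> \<le> K + \<bar>c\<bar> * L"
    using abs_triangle_ineq[of "f (t, \<omega>)" "c * g (t, \<omega>)"] by (simp add: abs_mult)
qed

lemma time_integral_lincomb:
  assumes "bounded_predictable K f" "bounded_predictable L g" "0 \<le> a" "b \<le> T" "\<omega> \<in> space M"
  shows "time_integral (\<lambda>x. f x + c * g x) a b \<omega> = time_integral f a b \<omega> + c * time_integral g a b \<omega>"
proof -
  have "time_integral f a b \<omega> + c * time_integral g a b \<omega>
    = (\<integral>s. f (s, \<omega>) * indicator {a..<b} s \<partial>lborel) + (\<integral>s. c * (g (s, \<omega>) * indicator {a..<b} s) \<partial>lborel)"
    by (simp add: time_integral_def)
  also have "\<dots> = (\<integral>s. f (s, \<omega>) * indicator {a..<b} s + c * (g (s, \<omega>) * indicator {a..<b} s) \<partial>lborel)"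
    using window_integrable[OF assms(1,3-5)] window_integrable[OF assms(2,3-5)]
    by (intro Bochner_Integration.integral_add[symmetric]) auto
  also have "\<dots> = time_integral (\<lambda>x. f x + c * g x) a b \<omega>"
    unfolding time_integral_def by (intro Bochner_Integration.integral_cong) (auto simp: distrib_right)
  finally show ?thesis by simp
qed

lemma deterministic_predictable:
  assumes "continuous_on {0..T} \<psi>" "\<And>t. t \<in> {0..T} \<Longrightarrow> \<bar>\<psi> t\<bar> \<le> K"
  shows "bounded_predictable K (\<lambda>(t, \<omega>). \<psi> t)"
proof -
  have f: "fst \<in> predictable_sigma T M N \<rightarrow>\<^sub>M restrict_space borel {0..T}"
    using fst_predictable by (intro measurable_restrict_space2) auto
  have "(\<lambda>x. \<psi> (fst x)) \<in> borel_measurable (predictable_sigma T M N)"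
    by (rule measurable_compose[OF f borel_measurable_continuous_on_restrict[OF assms(1)]])
  then show ?thesis using assms(2) by (simp add: bounded_predictable_def case_prod_beta)
qed

text \<open>The fundamental theorem of calculus. The half-open interval differs from the closed one by a null set.\<close>
lemma time_integral_derivative:
  assumes \<psi>: "\<And>t. t \<in> {0..T} \<Longrightarrow> (\<psi> has_real_derivative \<psi>' t) (at t within {0..T})"
    and cont: "continuous_on {0..T} \<psi>'" and ab: "0 \<le> a" "a \<le> b" "b \<le> T"
  shows "time_integral (\<lambda>(t, \<omega>). \<psi>' t) a b \<omega> = \<psi> b - \<psi> a"
proof -
  have sub: "{a..b} \<subseteq> {0..T}" using ab by auto
  have "(\<integral>s. indicator {a..b} s *\<^sub>R \<psi>' s \<partial>lborel) = \<psi> b - \<psi> a"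
  proof (rule integral_FTC_atLeastAtMost[OF ab(2)])
    fix x assume x: "a \<le> x" "x \<le> b"
    then show "(\<psi> has_vector_derivative \<psi>' x) (at x within {a..b})"
      using \<psi>[of x] ab DERIV_subset[OF _ sub]
      by (auto simp: has_real_derivative_iff_has_vector_derivative[symmetric])
  qed (rule continuous_on_subset[OF cont sub])
  moreover have "(\<integral>s. \<psi>' s * indicator {a..<b} s \<partial>lborel) = (\<integral>s. indicator {a..b} s *\<^sub>R \<psi>' s \<partial>lborel)"
  proof (rule integral_cong_AE)
    have "(\<lambda>s. indicator {a..b} s *\<^sub>R \<psi>' s) \<in> borel_measurable borel"
      by (intro borel_measurable_continuous_on_indicator continuous_on_subset[OF cont sub]) auto
    then show 1: "(\<lambda>s. indicator {a..b} s *\<^sub>R \<psi>' s) \<in> borel_measurable lborel" by simp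
    then have "(\<lambda>s. (indicator {a..b} s *\<^sub>R \<psi>' s) * indicator {a..<b} s) \<in> borel_measurable lborel"
      by measurable
    then show "(\<lambda>s. \<psi>' s * indicator {a..<b} s) \<in> borel_measurable lborel"
      by (rule measurable_cong[THEN iffD1, rotated]) (auto simp: indicator_def)
    show "AE s in lborel. \<psi>' s * indicator {a..<b} s = indicator {a..b} s *\<^sub>R \<psi>' s"
      using AE_lborel_singleton[of b] by eventually_elim (auto simp: indicator_def)
  qed
  ultimately show ?thesis by (simp add: time_integral_def)
qed

text \<open>
  Put \<open>F t\<close> for the expectation of \<open>\<phi> t (X t)\<close> and \<open>G t\<close> for the expected integral of \<open>g\<close> over \<open>[0, t)\<close>. The
  aim is \<open>F - G\<close> constant, for which quadratically small increments suffice.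
  On \<open>[a, b)\<close> everything is compared with the values at the state \<open>X a\<close>, which is known at \<open>a\<close>. If \<open>Z\<close> denotes the number of points in the slab
  over \<open>[a, b)\<close>, the comparison leaves a remainder \<open>R\<close> of three kinds, up to constants:
  \<open>Z (Z - 1)\<close> from linearising \<open>\<phi>\<close> in the jump size, which is exact for at most one jump;
  \<open>(b - a) Z\<close> from freezing the state, which is only wrong if there is a point at all; and
  \<open>(b - a)\<^sup>2\<close> from freezing the time in \<open>D\<close>. All three have mean \<open>O((b - a)\<^sup>2)\<close>, and what
  else remains is orthogonal to the past.
\<close>
lemma dynkin_formula:
  assumes \<Lambda>: "control C \<Lambda>"
    and deriv: "\<And>t n. t \<in> {0..T} \<Longrightarrow> ((\<lambda>s. \<phi> s n) has_real_derivative \<phi>' t n) (at t within {0..T})"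
    and cont: "\<And>n. continuous_on {0..T} (\<lambda>t. \<phi>' t n)"
    and bnd: "\<And>t n. t \<in> {0..T} \<Longrightarrow> \<bar>\<phi> t n\<bar> \<le> K" "\<And>t n. t \<in> {0..T} \<Longrightarrow> \<bar>\<phi>' t n\<bar> \<le> K"
  defines "X \<equiv> jumps \<Lambda> 0"
  defines "g \<equiv> \<lambda>(t, \<omega>). \<phi>' t (X t \<omega>) + \<Lambda> t \<omega> * (\<phi> t (Suc (X t \<omega>)) - \<phi> t (X t \<omega>))"
  shows "bounded_predictable (K + C * (2 * K)) g"
    and "(\<integral>\<omega>. \<phi> T (X T \<omega>) \<partial>M) - \<phi> 0 0 = (\<integral>\<omega>. time_integral g 0 T \<omega> \<partial>M)"
proof -
  define D where "D t n = \<phi> t (Suc n) - \<phi> t n" for t n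
  have C0: "0 \<le> C" by (rule control_bound_nonneg[OF \<Lambda>])
  have K0: "0 \<le> K" using bnd(1)[of 0 0] T_pos by auto
  have Dbnd: "\<bar>D t n\<bar> \<le> 2 * K" if "t \<in> {0..T}" for t n
    using bnd(1)[OF that, of n] bnd(1)[OF that, of "Suc n"] unfolding D_def by linarith
  have contD: "continuous_on {0..T} (\<lambda>t. D t n)" for n
    unfolding D_def using deriv by (intro continuous_on_diff DERIV_continuous_on) auto
  have bpL: "bounded_predictable C (\<lambda>(t, \<omega>). \<Lambda> t \<omega>)" by (rule control_bounded_predictable[OF \<Lambda>])
  show bpg: "bounded_predictable (K + C * (2 * K)) g"
    unfolding bounded_predictable_def
  proof (intro conjI ballI)
    have [measurable]: "(\<lambda>(t, \<omega>). \<phi>' t (X t \<omega>)) \<in> borel_measurable (predictable_sigma T M N)"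
      "(\<lambda>(t, \<omega>). D t (X t \<omega>)) \<in> borel_measurable (predictable_sigma T M N)"
      "(\<lambda>(t, \<omega>). \<Lambda> t \<omega>) \<in> borel_measurable (predictable_sigma T M N)"
      unfolding X_def using state_function_predictable[OF \<Lambda> cont] state_function_predictable[OF \<Lambda> contD] controlD(1)[OF \<Lambda>]
      by auto
    have "(\<lambda>x. (case x of (t, \<omega>) \<Rightarrow> \<phi>' t (X t \<omega>)) + (case x of (t, \<omega>) \<Rightarrow> \<Lambda> t \<omega>) * (case x of (t, \<omega>) \<Rightarrow> D t (X t \<omega>)))
      \<in> borel_measurable (predictable_sigma T M N)" by measurable
    then show "g \<in> borel_measurable (predictable_sigma T M N)"
      by (simp add: g_def D_def case_prod_beta')
    fix t \<omega> assume t: "t \<in> {0..T}" "\<omega> \<in> space M"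
    have "\<bar>\<Lambda> t \<omega> * D t (X t \<omega>)\<bar> \<le> C * (2 * K)"
      unfolding abs_mult using t controlD(2,3)[OF \<Lambda>, of t \<omega>] Dbnd[OF t(1)] C0
      by (intro mult_mono) auto
    then show "\<bar>g (t, \<omega>)\<bar> \<le> K + C * (2 * K)"
      using bnd(2)[OF t(1), of "X t \<omega>"] unfolding g_def D_def by auto
  qed
  have lip: "\<bar>\<phi> b n - \<phi> s n\<bar> \<le> K * (b - s)" if "0 \<le> s" "s \<le> b" "b \<le> T" for s b n
  proof -
    obtain \<omega> where w: "\<omega> \<in> space M" using not_empty by blast
    have "\<bar>time_integral (\<lambda>(t, \<omega>). \<phi>' t n) s b \<omega>\<bar> \<le> K * (b - s)"
      using that w bnd(2) by (intro time_integral_abs_le[OF deterministic_predictable[OF cont bnd(2)]]) auto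
    then show ?thesis using time_integral_derivative[OF deriv cont that] by simp
  qed
  define F where "F t = (\<integral>\<omega>. \<phi> t (X t \<omega>) \<partial>M)" for t
  define G where "G t = (\<integral>\<omega>. time_integral g 0 t \<omega> \<partial>M)" for t
  define L where "L = 4 * K * C\<^sup>2 + (2 * K + 4 * K * C) * C + 2 * K * C"
  have step: "\<bar>(F b - G b) - (F a - G a)\<bar> \<le> L * (b - a)\<^sup>2" if ab: "0 \<le> a" "a \<le> b" "b \<le> T" for a b
  proof -
    define J where "J = jumps \<Lambda> a b"
    define W where "W \<omega> = real (J \<omega>) - time_integral (\<lambda>(t, \<omega>). \<Lambda> t \<omega>) a b \<omega>" for \<omega>
    define Z where "Z = count (slab a b C)"
    \<comment> \<open>The coefficient of the compensated increment \<open>W\<close> is taken at the deterministic time \<open>b\<close>, but in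
      the state \<open>X a\<close>, so that it is known at time \<open>a\<close> and its product with \<open>W\<close> has mean 0.\<close>
    define R where "R \<omega> = \<phi> b (X b \<omega>) - \<phi> a (X a \<omega>) - time_integral g a b \<omega> - D b (X a \<omega>) * W \<omega>" for \<omega>
    define B where "B \<omega> = 4 * K * real (Z \<omega> * (Z \<omega> - 1)) + (b - a) * ((2 * K + 4 * K * C) * real (Z \<omega>) + 2 * K * C * (b - a))" for \<omega>
    have aT: "a \<le> T" "a \<in> {0..T}" "b \<in> {0..T}" using ab by auto
    have RB: "\<bar>R \<omega>\<bar> \<le> B \<omega>" if w: "\<omega> \<in> space M" for \<omega>
    proof -
      define n where "n = X a \<omega>"
      have Xb: "X b \<omega> = n + J \<omega>"
        unfolding n_def X_def J_def using jumps_add[OF \<Lambda> order_refl ab w] .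
      have JZ: "J \<omega> \<le> Z \<omega>" unfolding J_def Z_def using ab by (intro jumps_le_slab[OF \<Lambda> _ _ w]) auto
      have i: "\<bar>\<phi> b (n + J \<omega>) - \<phi> b n - D b n * real (J \<omega>)\<bar> \<le> 4 * K * real (Z \<omega> * (Z \<omega> - 1))"
      proof (cases "J \<omega> \<le> 1")
        case True
        then consider "J \<omega> = 0" | "J \<omega> = 1" by linarith
        then have "\<phi> b (n + J \<omega>) - \<phi> b n - D b n * real (J \<omega>) = 0"
          by cases (auto simp: D_def)
        then show ?thesis using K0 by simp
      next
        case False
        have "J \<omega> * 1 \<le> J \<omega> * (J \<omega> - 1)" using False by (intro mult_left_mono) auto
        also have "\<dots> \<le> Z \<omega> * (Z \<omega> - 1)" using JZ by (intro mult_mono) auto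
        finally have JZ2: "J \<omega> \<le> Z \<omega> * (Z \<omega> - 1)" by simp
        have "\<bar>D b n * real (J \<omega>)\<bar> \<le> 2 * K * real (J \<omega>)"
          unfolding abs_mult using Dbnd[OF aT(3)] K0 by (intro mult_mono) auto
        moreover have "\<bar>\<phi> b (n + J \<omega>)\<bar> \<le> K" "\<bar>\<phi> b n\<bar> \<le> K" using bnd(1)[OF aT(3)] by auto
        moreover have "2 * K * 1 \<le> 2 * K * real (J \<omega>)" using False K0 by (intro mult_left_mono) auto
        ultimately have "\<bar>\<phi> b (n + J \<omega>) - \<phi> b n - D b n * real (J \<omega>)\<bar> \<le> 4 * K * real (J \<omega>)"
          by linarith
        also have "\<dots> \<le> 4 * K * real (Z \<omega> * (Z \<omega> - 1))"
          using JZ2 K0 by (intro mult_left_mono of_nat_mono) auto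
        finally show ?thesis .
      qed
      \<comment> \<open>With the state frozen at \<open>n\<close>, \<open>h\<close> is a predictable process whose integral is the part of \<open>R\<close>
        that does not come from the jump sizes.\<close>
      define h where "h = (\<lambda>x. ((case x of (t, \<omega>) \<Rightarrow> \<phi>' t n) + D b n * (case x of (t, \<omega>) \<Rightarrow> \<Lambda> t \<omega>)) + (-1) * g x)"
      note bp1 = deterministic_predictable[OF cont[of n] bnd(2)[of _ n]]
      note bp2 = bounded_predictable_lincomb[OF bp1 bpL, of "D b n"]
      note bp3 = bounded_predictable_lincomb[OF bp2 bpg, of "-1"]
      have TIh: "time_integral h a b \<omega> = (\<phi> b n - \<phi> a n) + D b n * time_integral (\<lambda>(t, \<omega>). \<Lambda> t \<omega>) a b \<omega>
           - time_integral g a b \<omega>"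
        using time_integral_lincomb[OF bp2 bpg ab(1,3) w, of "-1"]
          time_integral_lincomb[OF bp1 bpL ab(1,3) w, of "D b n"]
          time_integral_derivative[OF deriv cont ab, of n \<omega>]
        unfolding h_def by linarith
      have ii: "\<bar>time_integral h a b \<omega>\<bar> \<le> (2 * K * real (Z \<omega>) + C * (2 * K * (b - a) + 4 * K * real (Z \<omega>))) * (b - a)"
      proof (rule time_integral_abs_le[OF bp3[folded h_def] ab w])
        fix s assume s: "a \<le> s" "s < b"
        then have sT: "s \<in> {0..T}" using ab by auto
        have 1: "\<bar>\<phi>' s n - \<phi>' s (X s \<omega>)\<bar> \<le> 2 * K * real (Z \<omega>) \<and> \<bar>D s n - D s (X s \<omega>)\<bar> \<le> 4 * K * real (Z \<omega>)"
        proof (cases "X s \<omega> = n")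
          case True
          then show ?thesis using K0 by simp
        next
          case False
          have "X s \<omega> = n + jumps \<Lambda> a s \<omega>" "J \<omega> = jumps \<Lambda> a s \<omega> + jumps \<Lambda> s b \<omega>"
            unfolding n_def X_def J_def using s ab
            by (auto intro!: jumps_add[OF \<Lambda> _ _ _ _ w])
          then have "1 \<le> Z \<omega>" using False JZ by linarith
          then have "2 * K * 1 \<le> 2 * K * real (Z \<omega>)" using K0 by (intro mult_left_mono) auto
          then show ?thesis
            using bnd(2)[OF sT, of n] bnd(2)[OF sT, of "X s \<omega>"] Dbnd[OF sT, of n] Dbnd[OF sT, of "X s \<omega>"]
            by linarith
        qed
        have "\<bar>D b n - D s n\<bar> \<le> 2 * (K * (b - s))"
          using lip[of s b n] lip[of s b "Suc n"] s ab unfolding D_def by linarith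
        also have "2 * (K * (b - s)) \<le> 2 * K * (b - a)"
          using s K0 mult_left_mono[of "b - s" "b - a" K] by simp
        finally have 2: "\<bar>D b n - D s (X s \<omega>)\<bar> \<le> 2 * K * (b - a) + 4 * K * real (Z \<omega>)"
          using 1 by linarith
        have L: "0 \<le> \<Lambda> s \<omega>" "\<Lambda> s \<omega> \<le> C" using controlD[OF \<Lambda>] sT w by auto
        have 3: "\<bar>\<Lambda> s \<omega> * (D b n - D s (X s \<omega>))\<bar> \<le> C * (2 * K * (b - a) + 4 * K * real (Z \<omega>))"
          unfolding abs_mult using L 2 C0 by (intro mult_mono) auto
        have "h (s, \<omega>) = (\<phi>' s n - \<phi>' s (X s \<omega>)) + \<Lambda> s \<omega> * (D b n - D s (X s \<omega>))"
          unfolding h_def g_def D_def by (simp add: algebra_simps)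
        then show "\<bar>h (s, \<omega>)\<bar> \<le> 2 * K * real (Z \<omega>) + C * (2 * K * (b - a) + 4 * K * real (Z \<omega>))"
          using 1 3 by linarith
      qed
      have "R \<omega> = (\<phi> b (n + J \<omega>) - \<phi> b n - D b n * real (J \<omega>)) + time_integral h a b \<omega>"
        unfolding TIh R_def W_def Xb n_def[symmetric] by (simp add: algebra_simps)
      then have "\<bar>R \<omega>\<bar> \<le> 4 * K * real (Z \<omega> * (Z \<omega> - 1)) + (2 * K * real (Z \<omega>) + C * (2 * K * (b - a) + 4 * K * real (Z \<omega>))) * (b - a)"
        using i ii by linarith
      then show ?thesis unfolding B_def by (simp add: algebra_simps)
    qed
    have Xint: "integrable M (\<lambda>\<omega>. \<phi> t (X t \<omega>))" if "t \<in> {0..T}" for t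
    proof (rule integrable_const_bound)
      show "AE \<omega> in M. norm (\<phi> t (X t \<omega>)) \<le> K" using bnd(1)[OF that] by simp
      have "X t \<in> M \<rightarrow>\<^sub>M count_space UNIV" unfolding X_def using that by (intro jumps_measurable[OF \<Lambda>]) auto
      then show "(\<lambda>\<omega>. \<phi> t (X t \<omega>)) \<in> borel_measurable M" by measurable
    qed
    have DXa: "(\<lambda>\<omega>. D b (X a \<omega>)) \<in> borel_measurable (history M N a)"
    proof -
      have "X a \<in> history M N a \<rightarrow>\<^sub>M count_space UNIV" unfolding X_def
        using ab by (intro jumps_history[OF \<Lambda>]) auto
      then show ?thesis by measurable
    qed
    note orth = compensated_jumps_orthogonal[OF \<Lambda> ab DXa, of "2 * K", OF Dbnd[OF aT(3)], folded J_def, folded W_def]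
    have gint: "integrable M (time_integral g a' b')" if "0 \<le> a'" "a' \<le> b'" "b' \<le> T" for a' b'
      by (rule time_integral_integrable[OF bpg that])
    have GG: "(\<integral>\<omega>. time_integral g a b \<omega> \<partial>M) = G b - G a"
    proof -
      have "G b = (\<integral>\<omega>. time_integral g 0 a \<omega> + time_integral g a b \<omega> \<partial>M)"
        unfolding G_def using ab by (intro Bochner_Integration.integral_cong time_integral_add[OF bpg]) auto
      also have "\<dots> = G a + (\<integral>\<omega>. time_integral g a b \<omega> \<partial>M)"
        unfolding G_def using gint[of 0 a] gint[of a b] ab by (intro Bochner_Integration.integral_add) auto
      finally show ?thesis by simp
    qed
    have Rint: "integrable M R"
      unfolding R_def using Xint[OF aT(2)] Xint[OF aT(3)] gint[OF ab] orth(1) by auto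
    have ER: "(\<integral>\<omega>. R \<omega> \<partial>M) = (F b - G b) - (F a - G a)"
      unfolding R_def using Xint[OF aT(2)] Xint[OF aT(3)] gint[OF ab] orth GG by (simp add: F_def)
    have box: "boxed (slab a b C)" using ab by (intro slab_boxed) auto
    note Z1 = expectation_count[OF box, folded Z_def] and Z2 = expectation_count_pair[OF box, folded Z_def]
    have Bint: "integrable M B"
      unfolding B_def using Z1(1) Z2(1) by (intro Bochner_Integration.integrable_add integrable_mult_right) auto
    have EB: "(\<integral>\<omega>. B \<omega> \<partial>M) = L * (b - a)\<^sup>2"
    proof -
      have "(\<integral>\<omega>. B \<omega> \<partial>M) = 4 * K * (\<integral>\<omega>. real (Z \<omega> * (Z \<omega> - 1)) \<partial>M)
        + (b - a) * ((2 * K + 4 * K * C) * (\<integral>\<omega>. real (Z \<omega>) \<partial>M) + 2 * K * C * (b - a))"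
        unfolding B_def using Z1(1) Z2(1) by (simp add: prob_space del: of_nat_mult)
      also have "\<dots> = L * (b - a)\<^sup>2"
        unfolding Z1(2) Z2(2) measure_slab[OF C0 ab(2)] L_def by (simp add: algebra_simps power2_eq_square)
      finally show ?thesis .
    qed
    have "\<bar>\<integral>\<omega>. R \<omega> \<partial>M\<bar> \<le> (\<integral>\<omega>. \<bar>R \<omega>\<bar> \<partial>M)" by (rule integral_abs_bound)
    also have "\<dots> \<le> (\<integral>\<omega>. B \<omega> \<partial>M)"
      using Rint Bint RB by (intro integral_mono) auto
    finally show ?thesis unfolding ER EB .
  qed
  have "F T - G T = F 0 - G 0"
    using T_pos step by (intro constant_if_quadratic_increments[where h="\<lambda>t. F t - G t"]) auto
  moreover have "F 0 = \<phi> 0 0"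
    unfolding F_def X_def by (simp add: jumps_same prob_space)
  moreover have "G 0 = 0"
    unfolding G_def time_integral_def by simp
  ultimately show "(\<integral>\<omega>. \<phi> T (X T \<omega>) \<partial>M) - \<phi> 0 0 = (\<integral>\<omega>. time_integral g 0 T \<omega> \<partial>M)"
    by (simp add: F_def G_def)
qed

section \<open>Feedback controls\<close>

lemma region_const_slab: "0 \<le> a \<Longrightarrow> b \<le> T \<Longrightarrow> region (\<lambda>_ _. C) a b \<omega> = slab a b C"
  by (auto simp: region_def slab_def strip_def)

lemma control_const: "0 \<le> C \<Longrightarrow> control C (\<lambda>_ _. C)"
  by (simp add: control_def case_prod_beta')

text \<open>Each iterate feeds the counting process of the previous iterate into the feedback function \<open>r\<close>.\<close>
primrec picard :: "(real \<Rightarrow> nat \<Rightarrow> real) \<Rightarrow> nat \<Rightarrow> real \<Rightarrow> 'a \<Rightarrow> real" where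
  "picard r 0 = (\<lambda>t \<omega>. 0)"
| "picard r (Suc k) = (\<lambda>t \<omega>. r t (jumps (picard r k) 0 t \<omega>))"

lemma picard_control:
  assumes r: "\<And>n. continuous_on {0..T} (\<lambda>t. r t n)" "\<And>t n. t \<in> {0..T} \<Longrightarrow> 0 \<le> r t n \<and> r t n \<le> C"
    and C: "0 \<le> C"
  shows "control C (picard r k)"
proof (induction k)
  case 0
  then show ?case using C by (simp add: control_def case_prod_beta')
next
  case (Suc k)
  then show ?case
    using state_function_predictable[OF Suc r(1)] r(2) by (auto simp: control_def)
qed

text \<open>
  As long as at most \<open>j\<close> points lie below the level \<open>C\<close> before time \<open>t\<close>, the paths of all iterates from the \<open>j\<close>-th on agree up to \<open>t\<close>.
  In the step from \<open>j\<close> to \<open>j + 1\<close>, two iterates have the same intensity at every time \<open>s < t\<close> that is preceded by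
  at most \<open>j\<close> points. If a time \<open>s\<close> is preceded by \<open>j + 1\<close> points, then there is no point left from some
  rational \<open>q < s\<close> up to \<open>t\<close>, by left-continuity. So the intensities can differ only over a countable union of
  empty slabs, which does not affect the counts. The argument does not enumerate the jump times, so simultaneous points do no harm.
\<close>
lemma picard_stable:
  assumes r: "\<And>n. continuous_on {0..T} (\<lambda>t. r t n)" "\<And>t n. t \<in> {0..T} \<Longrightarrow> 0 \<le> r t n \<and> r t n \<le> C"
    and C: "0 \<le> C" and w: "\<omega> \<in> space M"
  shows "t \<in> {0..T} \<Longrightarrow> jumps (\<lambda>_ _. C) 0 t \<omega> \<le> j \<Longrightarrow> j \<le> k \<Longrightarrow>
    jumps (picard r k) 0 t \<omega> = jumps (picard r j) 0 t \<omega>"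
proof (induction j arbitrary: t k)
  case 0
  have "jumps (picard r i) 0 t \<omega> = 0" for i
  proof -
    have "jumps (picard r i) 0 t \<omega> \<le> count (slab 0 t C) \<omega>"
      using 0 by (intro jumps_le_slab[OF picard_control[OF r C] _ _ w]) auto
    also have "count (slab 0 t C) \<omega> = jumps (\<lambda>_ _. C) 0 t \<omega>"
      using 0 by (simp add: jumps_def region_const_slab)
    finally show ?thesis using 0 by simp
  qed
  then show ?case by (simp only:)
next
  case (Suc j)
  let ?Y = "jumps (\<lambda>_ _. C) 0"
  have cC: "control C (\<lambda>_ _. C)" by (rule control_const[OF C])
  have pc: "control C (picard r k)" for k by (rule picard_control[OF r C])
  show ?case
  proof (cases "?Y t \<omega> \<le> j")
    case True
    then show ?thesis
      using Suc.IH[OF Suc.prems(1) True, of k] Suc.IH[OF Suc.prems(1) True, of "Suc j"] Suc.prems(3) by simp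
  next
    case False
    then have Yt: "?Y t \<omega> = Suc j" using Suc.prems by simp
    obtain k' where k': "k = Suc k'" "j \<le> k'" using Suc.prems(3) by (cases k) auto
    define Q where "Q = {q\<in>\<rat>. 0 \<le> q \<and> q < t \<and> Suc j \<le> ?Y q \<omega>}"
    define E where "E = (\<Union>q\<in>Q. slab q t C)"
    have "slab q t C \<in> null_sets (N \<omega>)" if "q \<in> Q" for q
    proof -
      have q: "0 \<le> q" "q < t" "Suc j \<le> ?Y q \<omega>" using that by (auto simp: Q_def)
      have "?Y t \<omega> = ?Y q \<omega> + jumps (\<lambda>_ _. C) q t \<omega>"
        using q Suc.prems(1) by (intro jumps_add[OF cC _ _ _ _ w]) auto
      then have "count (slab q t C) \<omega> = 0"
        using q Yt Suc.prems(1) by (simp add: jumps_def region_const_slab)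
      moreover have "boxed (slab q t C)" using q Suc.prems(1) by (intro slab_boxed) auto
      ultimately show ?thesis
        using emeasure_N[OF w, of "slab q t C"] by (auto simp: null_sets_def sets_N[OF w] boxed_def)
    qed
    moreover have "countable Q" unfolding Q_def using countable_rat by (rule countable_subset[rotated]) auto
    ultimately have E: "E \<in> null_sets (N \<omega>)" unfolding E_def by (intro null_sets_UN')
    have reg: "region (picard r i) 0 t \<omega> \<in> sets (N \<omega>)" for i
      using region_boxed[OF pc order_refl _ w, of t i] Suc.prems(1) by (auto simp: sets_N[OF w] boxed_def)
    have le: "region (picard r (Suc i)) 0 t \<omega> \<subseteq> region (picard r (Suc i')) 0 t \<omega> \<union> E"
      if "j \<le> i" "j \<le> i'" for i i'
    proof clarify
      fix s u assume su: "(s, u) \<in> region (picard r (Suc i)) 0 t \<omega>" "(s, u) \<notin> E"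
      then have s: "0 \<le> s" "s < t" "s \<in> {0..T}" "0 \<le> u" "u \<le> r s (jumps (picard r i) 0 s \<omega>)" "(s, u) \<in> strip T"
        using Suc.prems(1) by (auto simp: region_def strip_def)
      have uC: "u \<le> C" using r(2)[OF s(3), of "jumps (picard r i) 0 s \<omega>"] s(5) by linarith
      have "?Y s \<omega> \<le> j"
      proof (rule ccontr)
        assume "\<not> ?Y s \<omega> \<le> j"
        then obtain q where q: "q \<in> \<rat>" "0 \<le> q" "q < s" "Suc j \<le> ?Y q \<omega>"
          using jumps_left_continuous[OF cC _ w, of s "Suc j"] s(3) by auto
        then have "q \<in> Q" "(s, u) \<in> slab q t C" using s uC by (auto simp: Q_def slab_def)
        then show False using su(2) by (auto simp: E_def)
      qed
      then have "jumps (picard r i) 0 s \<omega> = jumps (picard r i') 0 s \<omega>"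
        using Suc.IH[OF s(3), of i] Suc.IH[OF s(3), of i'] that by simp
      then show "(s, u) \<in> region (picard r (Suc i')) 0 t \<omega>"
        using s by (simp add: region_def)
    qed
    have em: "emeasure (N \<omega>) (region (picard r (Suc i)) 0 t \<omega>) \<le> emeasure (N \<omega>) (region (picard r (Suc i')) 0 t \<omega>)"
      if "j \<le> i" "j \<le> i'" for i i'
    proof -
      have "emeasure (N \<omega>) (region (picard r (Suc i)) 0 t \<omega>) \<le> emeasure (N \<omega>) (region (picard r (Suc i')) 0 t \<omega> \<union> E)"
        by (intro emeasure_mono[OF le[OF that]] sets.Un reg null_setsD2[OF E])
      also have "\<dots> = emeasure (N \<omega>) (region (picard r (Suc i')) 0 t \<omega>)"
        by (rule emeasure_Un_null_set[OF reg E])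
      finally show ?thesis .
    qed
    have "emeasure (N \<omega>) (region (picard r (Suc k')) 0 t \<omega>) = emeasure (N \<omega>) (region (picard r (Suc j)) 0 t \<omega>)"
      using em[of k' j] em[of j k'] k' by (intro antisym) auto
    then show ?thesis
      unfolding k' jumps_def count_def measure_def by simp
  qed
qed

text \<open>
  By stability, the iteration is stationary on the path of \<open>\<omega>\<close> once it has run for more steps than there are points
  below the level \<open>C\<close>. That number depends on the whole path, so the limit
  is predictable not by its definition but as a pointwise limit of predictable processes.
\<close>
lemma feedback_control_exists:
  assumes r: "\<And>n. continuous_on {0..T} (\<lambda>t. r t n)" "\<And>t n. t \<in> {0..T} \<Longrightarrow> 0 \<le> r t n \<and> r t n \<le> C"
    and C: "0 \<le> C"
  obtains \<Lambda> where "control C \<Lambda>"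
    "\<And>t \<omega>. t \<in> {0..T} \<Longrightarrow> \<omega> \<in> space M \<Longrightarrow> \<Lambda> t \<omega> = r t (jumps \<Lambda> 0 t \<omega>)"
proof -
  have pc: "control C (picard r k)" for k by (rule picard_control[OF r C])
  define m where "m = jumps (\<lambda>_ _. C) 0 T"
  define \<Lambda> where "\<Lambda> t \<omega> = picard r (Suc (m \<omega>)) t \<omega>" for t \<omega>
  have st: "jumps (picard r k) 0 t \<omega> = jumps (picard r (m \<omega>)) 0 t \<omega>"
    if "t \<in> {0..T}" "\<omega> \<in> space M" "m \<omega> \<le> k" for t \<omega> k
  proof (rule picard_stable[OF r C that(2,1) _ that(3)])
    show "jumps (\<lambda>_ _. C) 0 t \<omega> \<le> m \<omega>"
      unfolding m_def using that by (intro jumps_mono[OF control_const[OF C]]) auto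
  qed
  have eq: "picard r k t \<omega> = \<Lambda> t \<omega>" if "t \<in> {0..T}" "\<omega> \<in> space M" "Suc (m \<omega>) \<le> k" for t \<omega> k
  proof -
    from \<open>Suc (m \<omega>) \<le> k\<close> obtain k' where "k = Suc k'" "m \<omega> \<le> k'" by (cases k) auto
    then show ?thesis using st[OF that(1,2), of k'] by (simp add: \<Lambda>_def)
  qed
  have "(\<lambda>(t, \<omega>). \<Lambda> t \<omega>) \<in> borel_measurable (predictable_sigma T M N)"
  proof (rule borel_measurable_LIMSEQ_real)
    show "(\<lambda>(t, \<omega>). picard r k t \<omega>) \<in> borel_measurable (predictable_sigma T M N)" for k
      by (rule controlD(1)[OF pc])
    fix x assume "x \<in> space (predictable_sigma T M N)"
    then obtain t \<omega> where x: "x = (t, \<omega>)" "t \<in> {0..T}" "\<omega> \<in> space M" by auto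
    have "\<forall>\<^sub>F k in sequentially. picard r k t \<omega> = \<Lambda> t \<omega>"
      using eq[OF x(2,3)] unfolding eventually_sequentially by blast
    then have "(\<lambda>k. picard r k t \<omega>) \<longlonglongrightarrow> \<Lambda> t \<omega>" by (rule tendsto_eventually)
    then show "(\<lambda>k. case x of (t, \<omega>) \<Rightarrow> picard r k t \<omega>) \<longlonglongrightarrow> (case x of (t, \<omega>) \<Rightarrow> \<Lambda> t \<omega>)"
      by (simp add: x(1))
  qed
  moreover have "0 \<le> \<Lambda> t \<omega> \<and> \<Lambda> t \<omega> \<le> C" if "t \<in> {0..T}" "\<omega> \<in> space M" for t \<omega>
    unfolding \<Lambda>_def using r(2)[OF that(1)] by simp
  ultimately have "control C \<Lambda>" by (auto simp: control_def)
  moreover have "\<Lambda> t \<omega> = r t (jumps \<Lambda> 0 t \<omega>)" if "t \<in> {0..T}" "\<omega> \<in> space M" for t \<omega>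
  proof -
    have "region \<Lambda> 0 t \<omega> = region (picard r (Suc (m \<omega>))) 0 t \<omega>"
      by (simp add: region_def \<Lambda>_def)
    then have "jumps \<Lambda> 0 t \<omega> = jumps (picard r (Suc (m \<omega>))) 0 t \<omega>" by (simp add: jumps_def)
    also have "\<dots> = jumps (picard r (m \<omega>)) 0 t \<omega>" by (rule st[OF that]) simp
    finally show ?thesis by (simp add: \<Lambda>_def)
  qed
  ultimately show ?thesis by (rule that)
qed

end

section \<open>The logarithmic value function\<close>

locale bounded_payoff =
  fixes f :: "nat \<Rightarrow> real" and B T :: real
  assumes f_bound: "\<bar>f n\<bar> \<le> B" and horizon_pos: "T > 0"
begin

text \<open>Up to the factor \<open>exp (- \<tau>)\<close>, the mean of \<open>exp (f (n + P))\<close> for \<open>P\<close> Poisson with parameter \<open>\<tau>\<close>.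
  Without this factor, differentiation in \<open>\<tau>\<close> is just the shift from \<open>n\<close> to \<open>n + 1\<close>.\<close>
definition payoff_series :: "real \<Rightarrow> nat \<Rightarrow> real" where
  "payoff_series \<tau> n = (\<Sum>k. exp (f (n + k)) / fact k * \<tau> ^ k)"

definition log_value :: "real \<Rightarrow> nat \<Rightarrow> real" where
  "log_value t n = ln (payoff_series (T - t) n) - (T - t)"

text \<open>The gain in the logarithmic value from one more point; its exponential is the optimal intensity.\<close>
definition slope :: "real \<Rightarrow> nat \<Rightarrow> real" where
  "slope t n = log_value t (Suc n) - log_value t n"

lemma exp_sums: "(\<lambda>k. \<tau> ^ k / fact k) sums exp (\<tau> :: real)"
  using exp_converges[of \<tau>] by (simp add: field_simps)

lemma exp_f: "exp (- B) \<le> exp (f n)" "exp (f n) \<le> exp B"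
  using f_bound[of n] by auto

lemma payoff_series_summable: "summable (\<lambda>k. exp (f (n + k)) / fact k * \<tau> ^ k)"
proof (rule summable_comparison_test')
  show "summable (\<lambda>k. exp B * (\<bar>\<tau>\<bar> ^ k / fact k))"
    using exp_sums[of "\<bar>\<tau>\<bar>"] by (intro summable_mult) (auto simp: sums_iff)
  show "norm (exp (f (n + k)) / fact k * \<tau> ^ k) \<le> exp B * (\<bar>\<tau>\<bar> ^ k / fact k)" for k
    using mult_right_mono[OF exp_f(2)[of "n + k"], of "\<bar>\<tau>\<bar> ^ k / fact k"]
    by (simp add: abs_mult power_abs)
qed

lemma payoff_series_bounds:
  assumes "0 \<le> \<tau>"
  shows "exp (- B) * exp \<tau> \<le> payoff_series \<tau> n" "payoff_series \<tau> n \<le> exp B * exp \<tau>"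
proof -
  have e: "(\<lambda>k. c * (\<tau> ^ k / fact k)) sums (c * exp \<tau>)" for c
    by (intro sums_mult exp_sums)
  have 1: "exp (- B) * (\<tau> ^ k / fact k) \<le> exp (f (n + k)) / fact k * \<tau> ^ k"
    and 2: "exp (f (n + k)) / fact k * \<tau> ^ k \<le> exp B * (\<tau> ^ k / fact k)" for k
    using mult_right_mono[OF exp_f(1)[of "n + k"], of "\<tau> ^ k / fact k"]
      mult_right_mono[OF exp_f(2)[of "n + k"], of "\<tau> ^ k / fact k"] assms by simp_all
  show "exp (- B) * exp \<tau> \<le> payoff_series \<tau> n"
    unfolding payoff_series_def by (rule sums_le[OF 1 e summable_sums[OF payoff_series_summable]])
  show "payoff_series \<tau> n \<le> exp B * exp \<tau>"
    unfolding payoff_series_def by (rule sums_le[OF 2 summable_sums[OF payoff_series_summable] e])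
qed

lemma payoff_series_pos: "0 \<le> \<tau> \<Longrightarrow> 0 < payoff_series \<tau> n"
  using payoff_series_bounds(1)[of \<tau> n] by (rule less_le_trans[rotated]) auto

lemma payoff_series_deriv: "((\<lambda>\<tau>. payoff_series \<tau> n) has_real_derivative payoff_series \<tau> (Suc n)) (at \<tau>)"
proof -
  have "diffs (\<lambda>k. exp (f (n + k)) / fact k) = (\<lambda>k. exp (f (Suc n + k)) / fact k)"
    by (intro ext) (simp add: diffs_def field_simps del: of_nat_Suc)
  then show ?thesis
    using termdiffs_strong_converges_everywhere[OF payoff_series_summable[of n], of \<tau>]
    unfolding payoff_series_def by simp
qed

lemma log_value_bound: assumes "t \<in> {0..T}" shows "\<bar>log_value t n\<bar> \<le> B"
proof -
  have \<tau>: "0 \<le> T - t" using assms by simp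
  have "ln (exp (- B) * exp (T - t)) \<le> ln (payoff_series (T - t) n)"
    using payoff_series_bounds(1)[OF \<tau>] payoff_series_pos[OF \<tau>] by (subst ln_le_cancel_iff) auto
  moreover have "ln (payoff_series (T - t) n) \<le> ln (exp B * exp (T - t))"
    using payoff_series_bounds(2)[OF \<tau>] payoff_series_pos[OF \<tau>] by (subst ln_le_cancel_iff) auto
  ultimately show ?thesis unfolding log_value_def by (simp add: ln_mult)
qed

lemma exp_slope: assumes "t \<in> {0..T}" shows "exp (slope t n) = payoff_series (T - t) (Suc n) / payoff_series (T - t) n"
proof -
  have \<tau>: "0 \<le> T - t" using assms by simp
  show ?thesis unfolding slope_def log_value_def by (simp add: exp_diff payoff_series_pos[OF \<tau>])
qed

text \<open>The backward equation: the time derivative of the series is its shift, and the quotient of the shifted series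
  by the series itself is the exponential of the slope.\<close>
lemma log_value_deriv:
  assumes "t \<in> {0..T}"
  shows "((\<lambda>s. log_value s n) has_real_derivative (1 - exp (slope t n))) (at t within {0..T})"
proof -
  have \<tau>: "0 \<le> T - t" using assms by simp
  have "((\<lambda>s. payoff_series (T - s) n) has_real_derivative payoff_series (T - t) (Suc n) * (- 1)) (at t within {0..T})"
    by (rule DERIV_chain2[OF payoff_series_deriv]) (auto intro!: derivative_eq_intros)
  then show ?thesis
    unfolding log_value_def exp_slope[OF assms] using payoff_series_pos[OF \<tau>, of n]
    by (auto intro!: derivative_eq_intros simp: field_simps)
qed

lemma slope_continuous: "continuous_on {0..T} (\<lambda>t. slope t n)"
  unfolding slope_def by (intro continuous_on_diff DERIV_continuous_on[OF log_value_deriv])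

lemma slope_bound: assumes "t \<in> {0..T}" shows "\<bar>slope t n\<bar> \<le> 2 * B"
  using log_value_bound[OF assms, of n] log_value_bound[OF assms, of "Suc n"] unfolding slope_def by linarith

lemma log_value_terminal: "log_value T n = f n"
proof -
  have "payoff_series 0 n = exp (f n)" unfolding payoff_series_def using powser_zero[of "\<lambda>k. exp (f (n + k)) / fact k"] by simp
  then show ?thesis by (simp add: log_value_def)
qed

lemma log_value_initial: "log_value 0 0 = ln (\<integral>n. exp (f n) \<partial>measure_pmf (poisson_pmf T))"
proof -
  have s: "(\<lambda>k. exp (f (0 + k)) / fact k * T ^ k * exp (- T)) sums (payoff_series T 0 * exp (- T))"
    unfolding payoff_series_def by (intro sums_mult2 summable_sums payoff_series_summable)
  have "(\<integral>n. exp (f n) \<partial>measure_pmf (poisson_pmf T))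
    = (\<integral>n. pmf (poisson_pmf T) n *\<^sub>R exp (f n) \<partial>count_space UNIV)"
    unfolding measure_pmf_eq_density by (subst integral_density) auto
  also have "\<dots> = (\<Sum>n. pmf (poisson_pmf T) n *\<^sub>R exp (f n))"
  proof (rule integral_count_space_nat)
    show "integrable (count_space UNIV) (\<lambda>n. pmf (poisson_pmf T) n *\<^sub>R exp (f n))"
      unfolding integrable_count_space_nat_iff
      using s horizon_pos by (simp add: sums_iff mult_ac abs_mult)
  qed
  also have "\<dots> = payoff_series T 0 * exp (- T)"
    using s horizon_pos by (simp add: sums_iff mult_ac)
  finally have I: "(\<integral>n. exp (f n) \<partial>measure_pmf (poisson_pmf T)) = payoff_series T 0 * exp (- T)" .
  have "0 < payoff_series T 0" using payoff_series_pos horizon_pos by simp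
  then show ?thesis unfolding I log_value_def by (simp add: ln_mult)
qed

end

section \<open>Legendre duality and the optimal control\<close>

definition entropy_cost :: "real \<Rightarrow> real" where
  "entropy_cost x = x * ln x - x + 1"

text \<open>
  Fenchel's inequality for the conjugate pair \<open>entropy_cost\<close> and \<open>exp y - 1\<close>. It is the tangent line bound
  \<open>1 + z \<le> exp z\<close> at \<open>z = y - ln x\<close>, multiplied by \<open>x\<close>; equality holds for \<open>x = exp y\<close>.
\<close>
lemma young_entropy:
  assumes "0 \<le> x" shows "x * y - exp y + 1 \<le> entropy_cost x"
proof (cases "x = 0")
  case False
  then have x: "0 < x" using assms by simp
  have "x * (1 + (y - ln x)) \<le> x * exp (y - ln x)"
    using x by (intro mult_left_mono exp_ge_add_one_self) auto
  also have "\<dots> = exp y" using x by (simp add: exp_diff)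
  finally show ?thesis unfolding entropy_cost_def by (simp add: algebra_simps)
qed (simp add: entropy_cost_def)

lemma entropy_cost_exp: "entropy_cost (exp y) = exp y * y - exp y + 1"
  by (simp add: entropy_cost_def)

lemma entropy_cost_bound:
  assumes "0 \<le> x" "x \<le> C" shows "\<bar>entropy_cost x\<bar> \<le> C\<^sup>2 + 1"
proof -
  have "0 \<le> entropy_cost x" using young_entropy[OF assms(1), of 0] by simp
  moreover have "x * ln x \<le> x * x"
  proof (cases "x = 0")
    case False
    then have "ln x \<le> x - 1" using assms by (intro ln_le_minus_one) auto
    then show ?thesis using assms by (intro mult_left_mono) auto
  qed simp
  moreover have "x * x \<le> C\<^sup>2" unfolding power2_eq_square using assms by (intro mult_mono) auto
  ultimately show ?thesis using assms unfolding entropy_cost_def by linarith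
qed

lemma entropy_cost_measurable [measurable]: "entropy_cost \<in> borel_measurable borel"
  unfolding entropy_cost_def[abs_def] by measurable

locale strip_poisson_payoff = strip_poisson M T N + bounded_payoff f B T
  for M :: "'a measure" and T :: real and N and f B
begin

text \<open>
  The Dynkin formula for the logarithmic value, whose time derivative is \<open>1 - exp (slope)\<close> by the
  backward equation. The defect \<open>gap\<close> is the slack in Fenchel's inequality along the path.
\<close>
lemma objective_eq:
  assumes \<Lambda>: "control C \<Lambda>"
  defines "gap \<equiv> \<lambda>(t, \<omega>). entropy_cost (\<Lambda> t \<omega>)
     - (\<Lambda> t \<omega> * slope t (jumps \<Lambda> 0 t \<omega>) - exp (slope t (jumps \<Lambda> 0 t \<omega>)) + 1)"
  shows "objective T M N f \<Lambda> = log_value 0 0 - (\<integral>\<omega>. time_integral gap 0 T \<omega> \<partial>M)"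
proof -
  define K where "K = B + (1 + exp (2 * B))"
  have B0: "0 \<le> B" using f_bound[of 0] by linarith
  have es: "exp (slope t n) \<le> exp (2 * B)" if "t \<in> {0..T}" for t n
    using slope_bound[OF that, of n] by simp
  have b1: "\<bar>log_value t n\<bar> \<le> K" and b2: "\<bar>1 - exp (slope t n)\<bar> \<le> K" if "t \<in> {0..T}" for t n
    using log_value_bound[OF that, of n] es[OF that, of n] B0 exp_gt_zero[of "slope t n"] exp_gt_zero[of "2 * B"]
    unfolding K_def by linarith+
  have cont: "continuous_on {0..T} (\<lambda>t. 1 - exp (slope t n))" for n
    by (intro continuous_intros slope_continuous)
  define g where "g = (\<lambda>(t, \<omega>). (1 - exp (slope t (jumps \<Lambda> 0 t \<omega>)))
      + \<Lambda> t \<omega> * (log_value t (Suc (jumps \<Lambda> 0 t \<omega>)) - log_value t (jumps \<Lambda> 0 t \<omega>)))"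
  have dyn: "bounded_predictable (K + C * (2 * K)) g"
    "(\<integral>\<omega>. log_value T (jumps \<Lambda> 0 T \<omega>) \<partial>M) - log_value 0 0 = (\<integral>\<omega>. time_integral g 0 T \<omega> \<partial>M)"
    unfolding g_def
    by (rule dynkin_formula[OF \<Lambda> log_value_deriv cont b1 b2]; assumption)+
  define l where "l = (\<lambda>(t, \<omega>). entropy_cost (\<Lambda> t \<omega>))"
  have bpl: "bounded_predictable (C\<^sup>2 + 1) l"
    unfolding bounded_predictable_def l_def
    using measurable_compose[OF controlD(1)[OF \<Lambda>] entropy_cost_measurable] entropy_cost_bound controlD(2,3)[OF \<Lambda>]
    by (auto simp: case_prod_beta')
  have gap: "gap = (\<lambda>x. l x + (-1) * g x)"
    unfolding gap_def l_def g_def slope_def by (auto simp: algebra_simps)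
  have TI: "(LINT t:{0..T}|lborel. (\<Lambda> t \<omega> * ln (\<Lambda> t \<omega>) - \<Lambda> t \<omega> + 1)) = time_integral l 0 T \<omega>" if "\<omega> \<in> space M" for \<omega>
    unfolding set_lebesgue_integral_def time_integral_def
  proof (rule integral_cong_AE)
    have *: "(\<lambda>s. l (s, \<omega>) * indicator {0..<T} s) \<in> borel_measurable lborel"
      by (rule window_measurable[OF bpl _ _ that]) auto
    then show "(\<lambda>s. l (s, \<omega>) * indicator {0..<T} s) \<in> borel_measurable lborel" .
    have "(\<lambda>s. l (s, \<omega>) * indicator {0..<T} s + l (T, \<omega>) * indicator {T} s) \<in> borel_measurable lborel"
      using * by simp
    then show "(\<lambda>t. indicator {0..T} t *\<^sub>R (\<Lambda> t \<omega> * ln (\<Lambda> t \<omega>) - \<Lambda> t \<omega> + 1)) \<in> borel_measurable lborel"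
      by (rule measurable_cong[THEN iffD1, rotated]) (use T_pos in \<open>auto simp: indicator_def l_def entropy_cost_def\<close>)
    show "AE t in lborel. indicator {0..T} t *\<^sub>R (\<Lambda> t \<omega> * ln (\<Lambda> t \<omega>) - \<Lambda> t \<omega> + 1) = l (t, \<omega>) * indicator {0..<T} t"
      using AE_lborel_singleton[of T] by eventually_elim (auto simp: indicator_def l_def entropy_cost_def)
  qed
  have Xint: "integrable M (\<lambda>\<omega>. f (jumps \<Lambda> 0 T \<omega>))"
  proof (rule integrable_const_bound)
    show "AE \<omega> in M. norm (f (jumps \<Lambda> 0 T \<omega>)) \<le> B" using f_bound by simp
    have "jumps \<Lambda> 0 T \<in> M \<rightarrow>\<^sub>M count_space UNIV" by (intro jumps_measurable[OF \<Lambda>]) auto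
    then show "(\<lambda>\<omega>. f (jumps \<Lambda> 0 T \<omega>)) \<in> borel_measurable M" by measurable
  qed
  have lint: "integrable M (time_integral l 0 T)"
    by (rule time_integral_integrable[OF bpl]) (use T_pos in auto)
  have gint: "integrable M (time_integral g 0 T)"
    by (rule time_integral_integrable[OF dyn(1)]) (use T_pos in auto)
  have "objective T M N f \<Lambda> = (\<integral>\<omega>. f (jumps \<Lambda> 0 T \<omega>) - time_integral l 0 T \<omega> \<partial>M)"
    unfolding objective_def counting_process_eq_jumps
    by (intro Bochner_Integration.integral_cong) (simp_all add: TI)
  also have "\<dots> = (\<integral>\<omega>. f (jumps \<Lambda> 0 T \<omega>) \<partial>M) - (\<integral>\<omega>. time_integral l 0 T \<omega> \<partial>M)"
    by (rule Bochner_Integration.integral_diff[OF Xint lint])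
  also have "(\<integral>\<omega>. f (jumps \<Lambda> 0 T \<omega>) \<partial>M) = log_value 0 0 + (\<integral>\<omega>. time_integral g 0 T \<omega> \<partial>M)"
    using dyn(2) by (simp add: log_value_terminal)
  also have "(\<integral>\<omega>. time_integral gap 0 T \<omega> \<partial>M) = (\<integral>\<omega>. time_integral l 0 T \<omega> - time_integral g 0 T \<omega> \<partial>M)"
    unfolding gap using T_pos
    by (intro Bochner_Integration.integral_cong) (auto simp: time_integral_lincomb[OF bpl dyn(1), of 0 T _ "-1", simplified])
  then have "(\<integral>\<omega>. time_integral l 0 T \<omega> \<partial>M) = (\<integral>\<omega>. time_integral gap 0 T \<omega> \<partial>M) + (\<integral>\<omega>. time_integral g 0 T \<omega> \<partial>M)"
    using lint gint by simp
  finally show ?thesis by simp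
qed

lemma objective_le:
  assumes \<Lambda>: "control C \<Lambda>"
  shows "objective T M N f \<Lambda> \<le> log_value 0 0"
proof -
  have "0 \<le> (\<integral>\<omega>. time_integral (\<lambda>(t, \<omega>). entropy_cost (\<Lambda> t \<omega>)
     - (\<Lambda> t \<omega> * slope t (jumps \<Lambda> 0 t \<omega>) - exp (slope t (jumps \<Lambda> 0 t \<omega>)) + 1)) 0 T \<omega> \<partial>M)"
    unfolding time_integral_def using young_entropy controlD(2)[OF \<Lambda>]
    by (intro Bochner_Integration.integral_nonneg_AE AE_I2 Bochner_Integration.integral_nonneg)
      (auto simp: indicator_def)
  then show ?thesis using objective_eq[OF \<Lambda>] by simp
qed

lemma objective_optimal:
  assumes \<Lambda>: "control C \<Lambda>"
    and feedback: "\<And>t \<omega>. t \<in> {0..T} \<Longrightarrow> \<omega> \<in> space M \<Longrightarrow> \<Lambda> t \<omega> = exp (slope t (jumps \<Lambda> 0 t \<omega>))"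
  shows "objective T M N f \<Lambda> = log_value 0 0"
proof -
  have "entropy_cost (\<Lambda> t \<omega>)
     - (\<Lambda> t \<omega> * slope t (jumps \<Lambda> 0 t \<omega>) - exp (slope t (jumps \<Lambda> 0 t \<omega>)) + 1) = 0"
    if "t \<in> {0..T}" "\<omega> \<in> space M" for t \<omega>
    unfolding feedback[OF that] entropy_cost_exp by simp
  then have "time_integral (\<lambda>(t, \<omega>). entropy_cost (\<Lambda> t \<omega>)
     - (\<Lambda> t \<omega> * slope t (jumps \<Lambda> 0 t \<omega>) - exp (slope t (jumps \<Lambda> 0 t \<omega>)) + 1)) 0 T \<omega> = integral\<^sup>L lborel (\<lambda>s::real. 0)"
    if "\<omega> \<in> space M" for \<omega>
    unfolding time_integral_def using that
    by (intro Bochner_Integration.integral_cong) (auto simp: indicator_def)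
  then have "(\<integral>\<omega>. time_integral (\<lambda>(t, \<omega>). entropy_cost (\<Lambda> t \<omega>)
     - (\<Lambda> t \<omega> * slope t (jumps \<Lambda> 0 t \<omega>) - exp (slope t (jumps \<Lambda> 0 t \<omega>)) + 1)) 0 T \<omega> \<partial>M) = (\<integral>\<omega>. 0 \<partial>M)"
    by (intro Bochner_Integration.integral_cong) auto
  then show ?thesis using objective_eq[OF \<Lambda>] by simp
qed

end

theorem theorem4p2:
  fixes f :: "nat \<Rightarrow> real" and T :: real
    and M :: "'a measure" and N :: "'a \<Rightarrow> (real \<times> real) measure"
  assumes "bounded (range f)"
    and "T > 0"
    and "poisson_point_process M (strip_lebesgue T) N"
  shows "ereal (ln (\<integral>n. exp (f n) \<partial>measure_pmf (poisson_pmf T)))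
           = (SUP \<Lambda>\<in>admissible T M N. ereal (objective T M N f \<Lambda>))
         \<and> (\<exists>\<Lambda>\<in>admissible T M N.
           ereal (objective T M N f \<Lambda>) = (SUP \<Lambda>'\<in>admissible T M N. ereal (objective T M N f \<Lambda>')))"
proof -
  obtain B where B: "\<And>n. \<bar>f n\<bar> \<le> B"
    using assms(1) unfolding bounded_iff by auto
  interpret poisson_point_process M "strip_lebesgue T" N by fact
  interpret strip_poisson_payoff M T N f B
    by unfold_locales (fact assms(2) B)+
  have B0: "0 \<le> B" using B[of 0] by linarith
  obtain \<Lambda>0 where \<Lambda>0: "control (exp (2 * B)) \<Lambda>0"
    "\<And>t \<omega>. t \<in> {0..T} \<Longrightarrow> \<omega> \<in> space M \<Longrightarrow> \<Lambda>0 t \<omega> = exp (slope t (jumps \<Lambda>0 0 t \<omega>))"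
  proof (rule feedback_control_exists[of "\<lambda>t n. exp (slope t n)" "exp (2 * B)"])
    show "continuous_on {0..T} (\<lambda>t. exp (slope t n))" for n
      by (intro continuous_intros slope_continuous)
    show "0 \<le> exp (slope t n) \<and> exp (slope t n) \<le> exp (2 * B)" if "t \<in> {0..T}" for t n
      using slope_bound[OF that, of n] by auto
  qed auto
  have opt: "objective T M N f \<Lambda>0 = log_value 0 0" by (rule objective_optimal[OF \<Lambda>0])
  have mem: "\<Lambda>0 \<in> admissible T M N" using \<Lambda>0(1) admissible_iff by blast
  have "(SUP \<Lambda>\<in>admissible T M N. ereal (objective T M N f \<Lambda>)) = ereal (log_value 0 0)"
  proof (rule antisym)
    show "(SUP \<Lambda>\<in>admissible T M N. ereal (objective T M N f \<Lambda>)) \<le> ereal (log_value 0 0)"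
    proof (rule SUP_least)
      fix \<Lambda> assume "\<Lambda> \<in> admissible T M N"
      then obtain C where "control C \<Lambda>" using admissible_iff by blast
      then show "ereal (objective T M N f \<Lambda>) \<le> ereal (log_value 0 0)"
        using objective_le by simp
    qed
    show "ereal (log_value 0 0) \<le> (SUP \<Lambda>\<in>admissible T M N. ereal (objective T M N f \<Lambda>))"
      using opt by (intro SUP_upper2[OF mem]) simp
  qed
  note sup = this
  show ?thesis
    unfolding sup log_value_initial[symmetric]
    using opt mem by (intro conjI bexI[of _ \<Lambda>0]) simp_all
qed

end
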